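(* Let $n\ge2$ be an integer. Equip $\mathrm{N}(n)$ with its LR-coarse structure and finite-dimensional real vector spaces $\mathbb{R}^K$ ($K$ a finite set) with the bounded coarse structure. Then: (1) The map $\alpha_0=\mu_{\{(1,n,1,1)\}}\circ\iota_{\mathrm{N}(n)}$ is coarse, where $\iota_{\mathrm{N}(n)}:\mathrm{N}(n)\to\mathrm{B}(n)$ is the inclusion. (2) The map $\alpha_i$ is controlled for all $i\in\{1,\dots,n-1\}$. (3) Let $I\subset\{0,1,\dots,n-1\}$ with $0\in I$, and let $\Lambda\subset\Lambda_1(n)$. Then the map $$(\alpha_I,\mu_\Lambda):\mathrm{N}(n)\to\mathbb{R}^{I\sqcup\Lambda},\quad X\mapsto(\alpha_i(X))_{i\in I}\oplus\mu_\Lambda(X)$$ is coarse; here, if $\Lambda=\emptyset$, $(\alpha_I,\mu_\Lambda)$ means $\alpha_I:=(\alpha_i)_{i\in I}$.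
   Context: $[n]:=\{1,\dots,n\}$. $\mathrm{B}(n)$ is the topological group of invertible real upper triangular $n\times n$ matrices, and $\mathrm{N}(n):=\{X\in\mathrm{B}(n) : x_{ii}=1 \text{ for all } i\in[n]\}$. For a real square matrix $X=(x_{ij})$, $\|X\|:=\max_{i,j}|x_{ij}|$. Define $\alpha_0:\mathrm{N}(n)\to\mathbb{R}$, $\alpha_0(X):=\log\|X\|$, and for $i\in[n-1]$, $\alpha_i:\mathrm{N}(n)\to\mathbb{R}$, $\alpha_i(X):=x_{i,i+1}$. For $1\le i\le j\le n$, $\Phi_{ij}:\mathrm{B}(n)\to\mathrm{B}(j-i+1)$ sends $X=(x_{st})_{1\le s,t\le n}$ to its submatrix $(x_{st})_{i\le s,t\le j}$. For $1\le q\le m$, $\bigwedge^q:\mathrm{GL}(m,\mathbb{R})\to\mathrm{GL}(\binom{m}{q},\mathbb{R})$ is the $q$-th exterior power (compound matrix): rows and columns are indexed by $q$-element subsets $I,J$ of $[m]$ in lexicographic order, and the $(I,J)$-entry of $\bigwedge^qA$ is the minor $\det(A_{IJ})$. $\Lambda_1(n):=\{(i,j,q,\varepsilon)\in[n]^3\times\{\pm1\} : i\le j,\ 1\le q\le j-i+1\}$. For nonempty $\Lambda\subset\Lambda_1(n)$ and $X\in\mathrm{B}(n)$, $\mu_\Lambda(X):=\bigl(\log\|\bigwedge^q\Phi_{ij}(X^\varepsilon)\|\bigr)_{(i,j,q,\varepsilon)\in\Lambda}\in\mathbb{R}^\Lambda$. A coarse structure on a set $S$ is a family $\mathcal{E}$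 of subsets of $S\times S$ (entourages) containing the diagonal and closed under transposition, finite unions, composition and passing to subsets. A subset $B\subset S$ is bounded if $B\times B\in\mathcal{E}$. The bounded coarse structure of a metric space consists of all $E$ with $\sup_{(x,y)\in E}d(x,y)<\infty$; on $\mathbb{R}^K$ use any norm metric. The LR-coarse structure on a locally compact Hausdorff group $G$ consists of all $E\subset G\times G$ such that, for some compact $C\subset G$, every $(x,y)\in E$ satisfies $x\in CyC^{-1}$. A map $f:(S,\mathcal{E})\to(T,\mathcal{F})$ is controlled if $\{(f(x),f(y)) : (x,y)\in E\}\in\mathcal{F}$ for every $E\in\mathcal{E}$; coarsely proper if preimages of bounded sets are bounded; coarse if it is both. *)

theory Defs
  imports
    "HOL-Algebra.Coset"
    "HOL-Analysis.Function_Topology"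
    "HOL-Analysis.Abstract_Metric_Spaces"
    "HOL-Analysis.L2_Norm"
    "Jordan_Normal_Form.Determinant"
    "Jordan_Normal_Form.DL_Submatrix"
begin

section \<open>Coarse structures and coarse maps\<close>

definition coarse_structure :: "'a set \<Rightarrow> ('a \<times> 'a) set set \<Rightarrow> bool" where
  "coarse_structure S \<E> \<longleftrightarrow>
     \<E> \<subseteq> Pow (S \<times> S) \<and> Id_on S \<in> \<E> \<and>
     (\<forall>E\<in>\<E>. E\<inverse> \<in> \<E>) \<and>
     (\<forall>E\<in>\<E>. \<forall>F\<in>\<E>. E \<union> F \<in> \<E>) \<and>
     (\<forall>E\<in>\<E>. \<forall>F\<in>\<E>. E O F \<in> \<E>) \<and>
     (\<forall>E\<in>\<E>. \<forall>F. F \<subseteq> E \<longrightarrow> F \<in> \<E>)"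

definition coarsely_bounded :: "('a \<times> 'a) set set \<Rightarrow> 'a set \<Rightarrow> bool" where
  "coarsely_bounded \<E> B \<longleftrightarrow> B \<times> B \<in> \<E>"

definition controlled_map ::
  "'a set \<Rightarrow> ('a \<times> 'a) set set \<Rightarrow> 'b set \<Rightarrow> ('b \<times> 'b) set set \<Rightarrow> ('a \<Rightarrow> 'b) \<Rightarrow> bool" where
  "controlled_map S \<E> T \<F> f \<longleftrightarrow>
     f \<in> S \<rightarrow> T \<and> (\<forall>E\<in>\<E>. {(f x, f y) | x y. (x, y) \<in> E} \<in> \<F>)"

definition coarsely_proper_map ::
  "'a set \<Rightarrow> ('a \<times> 'a) set set \<Rightarrow> 'b set \<Rightarrow> ('b \<times> 'b) set set \<Rightarrow> ('a \<Rightarrow> 'b) \<Rightarrow> bool" where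
  "coarsely_proper_map S \<E> T \<F> f \<longleftrightarrow>
     f \<in> S \<rightarrow> T \<and>
     (\<forall>B. B \<subseteq> T \<longrightarrow> coarsely_bounded \<F> B \<longrightarrow> coarsely_bounded \<E> {x \<in> S. f x \<in> B})"

definition coarse_map ::
  "'a set \<Rightarrow> ('a \<times> 'a) set set \<Rightarrow> 'b set \<Rightarrow> ('b \<times> 'b) set set \<Rightarrow> ('a \<Rightarrow> 'b) \<Rightarrow> bool" where
  "coarse_map S \<E> T \<F> f \<longleftrightarrow> controlled_map S \<E> T \<F> f \<and> coarsely_proper_map S \<E> T \<F> f"

definition bounded_coarse :: "'a set \<Rightarrow> ('a \<Rightarrow> 'a \<Rightarrow> real) \<Rightarrow> ('a \<times> 'a) set set" where
  "bounded_coarse S d = {E. E \<subseteq> S \<times> S \<and> (\<exists>b. \<forall>(x, y)\<in>E. d x y \<le> b)}"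

definition LR_coarse :: "('a, 'b) monoid_scheme \<Rightarrow> 'a topology \<Rightarrow> ('a \<times> 'a) set set" where
  "LR_coarse G T =
     {E. E \<subseteq> carrier G \<times> carrier G \<and>
         (\<exists>C. compactin T C \<and>
              (\<forall>(x, y)\<in>E. x \<in> (C #>\<^bsub>G\<^esub> y) <#>\<^bsub>G\<^esub> (set_inv\<^bsub>G\<^esub> C)))}"

text \<open>The space of real functions on a finite set \<open>K\<close> is represented by functions
  that are \<open>undefined\<close> outside \<open>K\<close>; it carries the Euclidean metric.\<close>

definition real_space :: "'k set \<Rightarrow> ('k \<Rightarrow> real) set" where
  "real_space K = K \<rightarrow>\<^sub>E UNIV"

definition real_space_dist :: "'k set \<Rightarrow> ('k \<Rightarrow> real) \<Rightarrow> ('k \<Rightarrow> real) \<Rightarrow> real" where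
  "real_space_dist K x y = L2_set (\<lambda>k. x k - y k) K"

abbreviation real_space_coarse :: "'k set \<Rightarrow> (('k \<Rightarrow> real) \<times> ('k \<Rightarrow> real)) set set" where
  "real_space_coarse K \<equiv> bounded_coarse (real_space K) (real_space_dist K)"

abbreviation real_line_coarse :: "(real \<times> real) set set" where
  "real_line_coarse \<equiv> bounded_coarse UNIV dist"


section \<open>Triangular matrices\<close>

text \<open>Indices of \<open>real mat\<close> start at \<open>0\<close>, so that the entry written \<open>x\<^sub>s\<^sub>t\<close> with
  \<open>s, t \<in> {1..n}\<close> is \<open>X $$ (s - 1, t - 1)\<close>. The labels \<open>i, j, q\<close> below
  start at \<open>1\<close>.\<close>

definition upper_group :: "nat \<Rightarrow> real mat monoid"  (\<open>\<B>\<close>) where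
  "\<B> n = \<lparr>carrier = {X \<in> carrier_mat n n. upper_triangular X \<and> invertible_mat X},
         monoid.mult = (*), one = 1\<^sub>m n\<rparr>"

definition unipotent_group :: "nat \<Rightarrow> real mat monoid"  (\<open>\<N>\<close>) where
  "\<N> n = (\<B> n)\<lparr>carrier := {X \<in> carrier (\<B> n). \<forall>i<n. X $$ (i, i) = 1}\<rparr>"

text \<open>The usual topology on square matrices, pulled back from the product topology along the
  map sending a matrix to its family of entries.\<close>

definition mat_topology :: "nat \<Rightarrow> real mat topology" where
  "mat_topology n =
     pullback_topology (carrier_mat n n) (\<lambda>X. \<lambda>p\<in>{..<n} \<times> {..<n}. X $$ p)
       (powertop_real ({..<n} \<times> {..<n}))"

abbreviation unipotent_coarse :: "nat \<Rightarrow> (real mat \<times> real mat) set set" where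
  "unipotent_coarse n \<equiv> LR_coarse (\<N> n) (subtopology (mat_topology n) (carrier (\<N> n)))"

definition mat_norm :: "real mat \<Rightarrow> real" where
  "mat_norm X = Max (abs ` elements_mat X)"

definition block :: "nat \<Rightarrow> nat \<Rightarrow> real mat \<Rightarrow> real mat"  (\<open>\<Phi>\<close>) where
  "\<Phi> i j X = submatrix X {i - 1..<j} {i - 1..<j}"

text \<open>\<open>subseqs\<close> lists the sublists that contain the first element before those that do not,
  so the sublists of any one length appear in lexicographic order.\<close>

definition lex_subsets :: "nat \<Rightarrow> nat \<Rightarrow> nat list list" where
  "lex_subsets m q = filter (\<lambda>I. length I = q) (subseqs [0..<m])"

definition ext_power :: "nat \<Rightarrow> real mat \<Rightarrow> real mat" where
  "ext_power q A =
     (let Is = lex_subsets (dim_row A) q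
      in mat (length Is) (length Is) (\<lambda>(a, b). det (submatrix A (set (Is ! a)) (set (Is ! b)))))"

definition Lambda1 :: "nat \<Rightarrow> (nat \<times> nat \<times> nat \<times> int) set"  (\<open>\<Lambda>\<^sub>1\<close>) where
  "\<Lambda>\<^sub>1 n = {(i, j, q, \<epsilon>). i \<in> {1..n} \<and> j \<in> {1..n} \<and> q \<in> {1..n} \<and> \<epsilon> \<in> {1, -1} \<and>
                       i \<le> j \<and> q \<le> j - i + 1}"

definition mu ::
  "nat \<Rightarrow> (nat \<times> nat \<times> nat \<times> int) set \<Rightarrow> real mat \<Rightarrow> (nat \<times> nat \<times> nat \<times> int) \<Rightarrow> real"  (\<open>\<mu>\<close>) where
  "\<mu> n \<Lambda> X = (\<lambda>(i, j, q, \<epsilon>)\<in>\<Lambda>. ln (mat_norm (ext_power q (\<Phi> i j (X [^]\<^bsub>\<B> n\<^esub> \<epsilon>)))))"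

definition alpha :: "nat \<Rightarrow> real mat \<Rightarrow> real"  (\<open>\<alpha>\<close>) where
  "\<alpha> i X = (if i = 0 then ln (mat_norm X) else X $$ (i - 1, i))"

text \<open>The disjoint union of \<open>I\<close> and \<open>\<Lambda>\<close> is \<open>I <+> \<Lambda>\<close>. For empty \<open>\<Lambda>\<close> the map below is
  \<open>(\<alpha>\<^sub>i)\<close> for \<open>i \<in> I\<close>, up to the relabelling \<open>Inl\<close> of coordinates.\<close>

definition alpha_mu ::
  "nat \<Rightarrow> nat set \<Rightarrow> (nat \<times> nat \<times> nat \<times> int) set \<Rightarrow> real mat
     \<Rightarrow> nat + (nat \<times> nat \<times> nat \<times> int) \<Rightarrow> real" where
  "alpha_mu n I \<Lambda> X = (\<lambda>k\<in>I <+> \<Lambda>. case k of Inl i \<Rightarrow> \<alpha> i X | Inr l \<Rightarrow> \<mu> n \<Lambda> X l)"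


section \<open>Well-formedness of these notions\<close>

lemma (in Metric_space) coarse_structure_bounded_coarse:
  "coarse_structure M (bounded_coarse M d)"
  unfolding coarse_structure_def
proof (intro conjI ballI allI impI)
  show "Id_on M \<in> bounded_coarse M d"
    by (force simp: bounded_coarse_def)
next
  fix E assume "E \<in> bounded_coarse M d"
  then show "E\<inverse> \<in> bounded_coarse M d"
    by (fastforce simp: bounded_coarse_def commute)
next
  fix E F assume EF: "E \<in> bounded_coarse M d" "F \<in> bounded_coarse M d"
  then obtain b c where *: "\<forall>(x, y)\<in>E. d x y \<le> b" "\<forall>(x, y)\<in>F. d x y \<le> c"
    and sub: "E \<subseteq> M \<times> M" "F \<subseteq> M \<times> M"
    unfolding bounded_coarse_def by blast
  have "\<forall>(x, y)\<in>E \<union> F. d x y \<le> max b c"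
    using * by fastforce
  then show "E \<union> F \<in> bounded_coarse M d"
    using sub unfolding bounded_coarse_def by blast
  have "d x z \<le> b + c" if "(x, z) \<in> E O F" for x z
  proof -
    from that obtain y where y: "(x, y) \<in> E" "(y, z) \<in> F" by auto
    then have "d x z \<le> d x y + d y z" using sub triangle by blast
    then show ?thesis using y * by fastforce
  qed
  then show "E O F \<in> bounded_coarse M d"
    using sub unfolding bounded_coarse_def by blast
next
  fix E F assume "E \<in> bounded_coarse M d" "F \<subseteq> E"
  then show "F \<in> bounded_coarse M d"
    unfolding bounded_coarse_def by blast
qed (auto simp: bounded_coarse_def)

lemma Metric_space_real_space:
  assumes "finite K"
  shows "Metric_space (real_space K) (real_space_dist K)"
proof
  fix x y z :: "'a \<Rightarrow> real"
  show "0 \<le> real_space_dist K x y"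
    by (simp add: real_space_dist_def)
  show "real_space_dist K x y = real_space_dist K y x"
    by (simp add: real_space_dist_def L2_set_def power2_commute)
  show "real_space_dist K x y = 0 \<longleftrightarrow> x = y" if "x \<in> real_space K" "y \<in> real_space K"
    using that assms
    by (auto simp: real_space_dist_def L2_set_eq_0_iff real_space_def intro: PiE_ext)
  show "real_space_dist K x z \<le> real_space_dist K x y + real_space_dist K y z"
    using L2_set_triangle_ineq[of "\<lambda>k. x k - y k" "\<lambda>k. y k - z k" K]
    by (simp add: real_space_dist_def)
qed

lemma coarse_structure_LR_coarse:
  fixes G (structure)
  assumes "group G" and top: "topspace T = carrier G"
    and mult: "continuous_map (prod_topology T T) T (\<lambda>(x, y). x \<otimes>\<^bsub>G\<^esub> y)"
    and inv: "continuous_map T T (\<lambda>x. inv\<^bsub>G\<^esub> x)"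
  shows "coarse_structure (carrier G) (LR_coarse G T)"
proof -
  interpret group G by fact
  have mem: "x \<in> (C #> y) <#> (set_inv C) \<longleftrightarrow> (\<exists>c\<in>C. \<exists>d\<in>C. x = c \<otimes> y \<otimes> inv d)" for C x y
    by (auto simp: r_coset_def set_mult_def SET_INV_def)
  have sub: "C \<subseteq> carrier G" if "compactin T C" for C
    using compactin_subset_topspace[OF that] top by simp
  have LR: "E \<in> LR_coarse G T \<longleftrightarrow> E \<subseteq> carrier G \<times> carrier G \<and>
     (\<exists>C. compactin T C \<and> (\<forall>x y. (x, y) \<in> E \<longrightarrow> (\<exists>c\<in>C. \<exists>d\<in>C. x = c \<otimes> y \<otimes> inv d)))" for E
    by (auto simp: LR_coarse_def mem)
  show ?thesis
    unfolding coarse_structure_def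
  proof (intro conjI ballI allI impI)
    show "LR_coarse G T \<subseteq> Pow (carrier G \<times> carrier G)"
      by (auto simp: LR)
    have "compactin T {\<one>}" using top by (simp add: finite_imp_compactin)
    then show "Id_on (carrier G) \<in> LR_coarse G T"
      unfolding LR by (intro conjI exI[of _ "{\<one>}"]) auto
  next
    fix E assume "E \<in> LR_coarse G T"
    then obtain C where E: "E \<subseteq> carrier G \<times> carrier G" and C: "compactin T C"
      and *: "\<And>x y. (x, y) \<in> E \<Longrightarrow> \<exists>c\<in>C. \<exists>d\<in>C. x = c \<otimes> y \<otimes> inv d"
      unfolding LR by auto
    have "\<exists>c\<in>m_inv G ` C. \<exists>d\<in>m_inv G ` C. x = c \<otimes> y \<otimes> inv d" if yx: "(y, x) \<in> E" for x y
    proof -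
      obtain c d where cd: "c \<in> C" "d \<in> C" "y = c \<otimes> x \<otimes> inv d" using *[OF yx] by auto
      have "c \<in> carrier G" "d \<in> carrier G" "x \<in> carrier G" using cd sub[OF C] E yx by auto
      then have "x = inv c \<otimes> y \<otimes> inv (inv d)" using cd
        by (simp add: m_assoc) (simp add: m_assoc[symmetric])
      then show ?thesis using cd by blast
    qed
    then show "E\<inverse> \<in> LR_coarse G T"
      unfolding LR using E image_compactin[OF C inv] by blast
  next
    fix E F assume "E \<in> LR_coarse G T" "F \<in> LR_coarse G T"
    then obtain C D where EF: "E \<subseteq> carrier G \<times> carrier G" "F \<subseteq> carrier G \<times> carrier G"
      and C: "compactin T C" and D: "compactin T D"
      and E: "\<And>x y. (x, y) \<in> E \<Longrightarrow> \<exists>c\<in>C. \<exists>d\<in>C. x = c \<otimes> y \<otimes> inv d"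
      and F: "\<And>x y. (x, y) \<in> F \<Longrightarrow> \<exists>c\<in>D. \<exists>d\<in>D. x = c \<otimes> y \<otimes> inv d"
      unfolding LR by auto
    show "E \<union> F \<in> LR_coarse G T"
      unfolding LR using EF E F compactin_Un[OF C D] by (intro conjI exI[of _ "C \<union> D"]) blast+
    let ?CD = "(\<lambda>(x, y). x \<otimes> y) ` (C \<times> D)"
    have CD: "compactin T ?CD"
      using image_compactin[OF _ mult] C D by (simp add: compactin_Times)
    have "\<exists>c\<in>?CD. \<exists>d\<in>?CD. x = c \<otimes> z \<otimes> inv d" if xz: "(x, z) \<in> E O F" for x z
    proof -
      obtain y where y: "(x, y) \<in> E" "(y, z) \<in> F" using xz by auto
      obtain c d where cd: "c \<in> C" "d \<in> C" "x = c \<otimes> y \<otimes> inv d" using E[OF y(1)] by auto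
      obtain c' d' where cd': "c' \<in> D" "d' \<in> D" "y = c' \<otimes> z \<otimes> inv d'" using F[OF y(2)] by auto
      have "c \<in> carrier G" "d \<in> carrier G" "c' \<in> carrier G" "d' \<in> carrier G" "z \<in> carrier G"
        using cd cd' sub[OF C] sub[OF D] EF y by auto
      then have "x = (c \<otimes> c') \<otimes> z \<otimes> inv (d \<otimes> d')"
        using cd cd' by (simp add: m_assoc inv_mult_group)
      then show ?thesis using cd cd' by force
    qed
    then show "E O F \<in> LR_coarse G T"
      unfolding LR using EF CD by blast
  next
    fix E F assume "E \<in> LR_coarse G T" "F \<subseteq> E"
    then show "F \<in> LR_coarse G T"
      unfolding LR by blast
  qed
qed

lemma upper_group_simps [simp]:
  "X \<in> carrier (\<B> n) \<longleftrightarrow> X \<in> carrier_mat n n \<and> upper_triangular X \<and> invertible_mat X"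
  "X \<otimes>\<^bsub>\<B> n\<^esub> Y = X * Y" "\<one>\<^bsub>\<B> n\<^esub> = 1\<^sub>m n"
  by (simp_all add: upper_group_def)

lemma unipotent_group_simps [simp]:
  "X \<in> carrier (\<N> n) \<longleftrightarrow> X \<in> carrier (\<B> n) \<and> (\<forall>i<n. X $$ (i, i) = 1)"
  "X \<otimes>\<^bsub>\<N> n\<^esub> Y = X * Y" "\<one>\<^bsub>\<N> n\<^esub> = 1\<^sub>m n"
  by (simp_all add: unipotent_group_def upper_group_def)

lemma invertible_matI:
  "X \<in> carrier_mat n n \<Longrightarrow> Y \<in> carrier_mat n n \<Longrightarrow> X * Y = 1\<^sub>m n \<Longrightarrow> Y * X = 1\<^sub>m n
    \<Longrightarrow> invertible_mat X"
  by (auto simp: invertible_mat_def inverts_mat_def intro!: exI[of _ Y])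

lemma invertible_matE:
  assumes "invertible_mat X" "X \<in> carrier_mat n n"
  obtains Y where "Y \<in> carrier_mat n n" "X * Y = 1\<^sub>m n" "Y * X = 1\<^sub>m n"
proof -
  obtain Y where "inverts_mat X Y" "inverts_mat Y X"
    using assms by (auto simp: invertible_mat_def)
  then have XY: "X * Y = 1\<^sub>m n" and YX: "Y * X = 1\<^sub>m (dim_row Y)"
    using assms by (auto simp: inverts_mat_def)
  have "dim_col Y = n" using arg_cong[OF XY, of dim_col] by simp
  moreover have "dim_row Y = n" using arg_cong[OF YX, of dim_col] assms by simp
  ultimately show ?thesis using that[of Y] XY YX by auto
qed

lemma index_mult_upper:
  assumes "X \<in> carrier_mat n n" "Y \<in> carrier_mat n n" "i < n" "j < n"
  shows "(X * Y) $$ (i, j) = (\<Sum>k<n. X $$ (i, k) * Y $$ (k, j) :: real)"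
  using assms by (auto simp: times_mat_def scalar_prod_def lessThan_atLeast0 intro!: sum.cong)

lemma upper_triangular_mult:
  assumes X: "X \<in> carrier_mat n n" "upper_triangular X"
    and Y: "Y \<in> carrier_mat n n" "upper_triangular (Y :: real mat)"
  shows "upper_triangular (X * Y)"
    and "i < n \<Longrightarrow> (X * Y) $$ (i, i) = X $$ (i, i) * Y $$ (i, i)"
proof -
  have 0: "X $$ (i, k) * Y $$ (k, j) = 0" if "i < n" "k < n" "k < i \<or> j < k" for i j k
    using that X Y by (auto dest: upper_triangularD)
  show "upper_triangular (X * Y)"
  proof
    fix i j assume "j < i" "i < dim_row (X * Y)"
    then have ij: "i < n" "j < n" "j < i" using X by auto
    have "(\<Sum>k<n. X $$ (i, k) * Y $$ (k, j)) = 0"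
      using ij by (intro sum.neutral ballI 0) auto
    then show "(X * Y) $$ (i, j) = 0"
      using index_mult_upper[OF X(1) Y(1) ij(1,2)] by simp
  qed
  assume i: "i < n"
  then have "(X * Y) $$ (i, i) = (\<Sum>k<n. X $$ (i, k) * Y $$ (k, i))"
    using X Y by (simp add: index_mult_upper del: index_mult_mat)
  also have "\<dots> = (\<Sum>k\<in>{i}. X $$ (i, k) * Y $$ (k, i))"
    using i by (intro sum.mono_neutral_right ballI 0) auto
  finally show "(X * Y) $$ (i, i) = X $$ (i, i) * Y $$ (i, i)" by simp
qed

lemma upper_triangular_inverse:
  assumes X: "X \<in> carrier_mat n n" "upper_triangular X"
    and Y: "Y \<in> carrier_mat n n" and XY: "X * Y = 1\<^sub>m n" "Y * X = (1\<^sub>m n :: real mat)"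
  shows "upper_triangular Y"
proof -
  have "det X * det Y = 1" using det_mult[OF X(1) Y] XY by simp
  then have "0 \<notin> set (diag_mat X)"
    using upper_triangular_imp_det_eq_0_iff[OF X] by auto
  then have diag: "X $$ (i, i) \<noteq> 0" if "i < n" for i
    using that X by (auto simp: diag_mat_def)
  have "i < n \<longrightarrow> j < i \<longrightarrow> Y $$ (i, j) = 0" for i j
  proof (induction "n - i" arbitrary: i rule: less_induct)
    case less
    show ?case
    proof (intro impI)
      assume ij: "i < n" "j < i"
      have "0 = (\<Sum>k<n. X $$ (i, k) * Y $$ (k, j))"
        using ij X Y index_mult_upper[of X n Y i j] XY by simp
      also have "\<dots> = (\<Sum>k\<in>{i}. X $$ (i, k) * Y $$ (k, j))"
      proof (intro sum.mono_neutral_right ballI)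
        fix k assume "k \<in> {..<n} - {i}"
        then consider "k < i" | "i < k" "k < n" by fastforce
        then show "X $$ (i, k) * Y $$ (k, j) = 0"
          using X ij less[of k] by cases (auto dest: upper_triangularD)
      qed (use ij in auto)
      finally show "Y $$ (i, j) = 0" using diag ij by simp
    qed
  qed
  then show ?thesis using Y by auto
qed

lemma group_upper_group: "group (\<B> n)"
proof (rule groupI)
  fix X Y assume "X \<in> carrier (\<B> n)" "Y \<in> carrier (\<B> n)"
  then have X: "X \<in> carrier_mat n n" "upper_triangular X" "invertible_mat X"
    and Y: "Y \<in> carrier_mat n n" "upper_triangular Y" "invertible_mat Y" by auto
  obtain X' where X': "X' \<in> carrier_mat n n" "X * X' = 1\<^sub>m n" "X' * X = 1\<^sub>m n"
    using invertible_matE X by metis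
  obtain Y' where Y': "Y' \<in> carrier_mat n n" "Y * Y' = 1\<^sub>m n" "Y' * Y = 1\<^sub>m n"
    using invertible_matE Y by metis
  have "(X * Y) * (Y' * X') = X * (Y * Y') * X'" "(Y' * X') * (X * Y) = Y' * (X' * X) * Y"
    using X(1) Y(1) X'(1) Y'(1)
    by (smt (verit) assoc_mult_mat mult_carrier_mat)+
  then have "invertible_mat (X * Y)"
    using X(1) Y(1) X' Y' by (intro invertible_matI[of _ n "Y' * X'"]) auto
  then show "X \<otimes>\<^bsub>\<B> n\<^esub> Y \<in> carrier (\<B> n)"
    using X Y upper_triangular_mult(1)[of X n Y] by simp
next
  show "\<one>\<^bsub>\<B> n\<^esub> \<in> carrier (\<B> n)"
    by (auto intro: invertible_matI[of _ n "1\<^sub>m n"])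
next
  fix X assume "X \<in> carrier (\<B> n)"
  then have X: "X \<in> carrier_mat n n" "upper_triangular X" "invertible_mat X" by auto
  obtain X' where X': "X' \<in> carrier_mat n n" "X * X' = 1\<^sub>m n" "X' * X = 1\<^sub>m n"
    using invertible_matE X by metis
  then have "X' \<in> carrier (\<B> n)"
    using X upper_triangular_inverse[OF X(1,2) X'] invertible_matI[of X' n X] by simp
  then show "\<exists>Y\<in>carrier (\<B> n). Y \<otimes>\<^bsub>\<B> n\<^esub> X = \<one>\<^bsub>\<B> n\<^esub>"
    using X' by auto
qed auto

lemma group_unipotent_group: "group (\<N> n)"
proof -
  interpret B: group "\<B> n" by (rule group_upper_group)
  show ?thesis
  proof (rule groupI)
    fix X Y assume XY: "X \<in> carrier (\<N> n)" "Y \<in> carrier (\<N> n)"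
    then have "X * Y \<in> carrier (\<B> n)" using B.m_closed[of X Y] by simp
    then show "X \<otimes>\<^bsub>\<N> n\<^esub> Y \<in> carrier (\<N> n)"
      using XY by (auto simp: upper_triangular_mult(2) simp del: index_mult_mat)
  next
    show "\<one>\<^bsub>\<N> n\<^esub> \<in> carrier (\<N> n)" using B.one_closed by simp
  next
    fix X assume X: "X \<in> carrier (\<N> n)"
    define Y where "Y = inv\<^bsub>\<B> n\<^esub> X"
    have Y: "Y \<in> carrier (\<B> n)" "Y * X = 1\<^sub>m n"
      using X B.inv_closed[of X] B.l_inv[of X] by (auto simp: Y_def)
    have "Y $$ (i, i) = 1" if "i < n" for i
      using upper_triangular_mult(2)[of Y n X i] X Y that by simp
    then show "\<exists>Y\<in>carrier (\<N> n). Y \<otimes>\<^bsub>\<N> n\<^esub> X = \<one>\<^bsub>\<N> n\<^esub>"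
      using Y by auto
  qed auto
qed

lemma topspace_mat_topology [simp]: "topspace (mat_topology n) = carrier_mat n n"
  by (auto simp: mat_topology_def topspace_pullback_topology)

lemma continuous_map_mat_entry:
  assumes "continuous_map T (mat_topology n) f" "i < n" "j < n"
  shows "continuous_map T euclideanreal (\<lambda>x. f x $$ (i, j))"
proof -
  have "continuous_map (mat_topology n) euclideanreal
     ((\<lambda>g. g (i, j)) \<circ> (\<lambda>X. \<lambda>p\<in>{..<n} \<times> {..<n}. X $$ p))"
    unfolding mat_topology_def
    using assms by (intro continuous_map_pullback continuous_map_product_projection) auto
  then have "continuous_map T euclideanreal
     (((\<lambda>g. g (i, j)) \<circ> (\<lambda>X. \<lambda>p\<in>{..<n} \<times> {..<n}. X $$ p)) \<circ> f)"
    using assms continuous_map_compose by blast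
  then show ?thesis using assms by (simp add: o_def)
qed

lemma continuous_map_into_mat_topology:
  assumes "\<And>x. x \<in> topspace T \<Longrightarrow> f x \<in> carrier_mat n n"
    and "\<And>i j. i < n \<Longrightarrow> j < n \<Longrightarrow> continuous_map T euclideanreal (\<lambda>x. f x $$ (i, j))"
  shows "continuous_map T (mat_topology n) f"
  unfolding mat_topology_def
  using assms by (intro continuous_map_pullback') (auto simp: continuous_map_componentwise o_def)

lemma continuous_map_unipotent_inverse:
  fixes n
  defines "T \<equiv> subtopology (mat_topology n) (carrier (\<N> n))"
  shows "continuous_map T T (\<lambda>X. inv\<^bsub>\<N> n\<^esub> X)"
proof -
  interpret N: group "\<N> n" by (rule group_unipotent_group)
  have topT: "topspace T = carrier (\<N> n)" by (auto simp: T_def)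
  have T: "continuous_map T (mat_topology n) (\<lambda>X. X)"
    unfolding T_def by (simp add: continuous_map_from_subtopology)
  have inv_eq: "inv\<^bsub>\<N> n\<^esub> X = adj_mat X" if "X \<in> carrier (\<N> n)" for X
  proof -
    have X: "X \<in> carrier_mat n n" "upper_triangular X" "\<forall>i<n. X $$ (i, i) = 1" using that by auto
    have "diag_mat X = replicate n 1" using X by (auto simp: diag_mat_def intro: nth_equalityI)
    then have "det X = 1" using det_upper_triangular[OF X(2,1)] by simp
    then have adj: "adj_mat X \<in> carrier_mat n n" "X * adj_mat X = 1\<^sub>m n" using adj_mat[OF X(1)] by auto
    have inv: "inv\<^bsub>\<N> n\<^esub> X \<in> carrier_mat n n" "inv\<^bsub>\<N> n\<^esub> X * X = 1\<^sub>m n"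
      using N.inv_closed[OF that] N.l_inv[OF that] by auto
    have "inv\<^bsub>\<N> n\<^esub> X = inv\<^bsub>\<N> n\<^esub> X * (X * adj_mat X)" using inv adj by simp
    also have "\<dots> = (inv\<^bsub>\<N> n\<^esub> X * X) * adj_mat X"
      using inv(1) X(1) adj(1) by (simp add: assoc_mult_mat[of _ n n _ n _ n])
    also have "\<dots> = adj_mat X" using inv adj by simp
    finally show ?thesis .
  qed
  have entry: "continuous_map T euclideanreal (\<lambda>X. adj_mat X $$ (i, j))" if ij: "i < n" "j < n" for i j
  proof -
    define e where "e k l = (if k < j then k else Suc k, if l < i then l else Suc l)" for k l
    have e: "fst (e k l) < n" "snd (e k l) < n" if "k < n - 1" "l < n - 1" for k l
      using that ij by (auto simp: e_def)
    have "continuous_map T euclideanreal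
       (\<lambda>X. (-1) ^ (j + i) * (\<Sum>p | p permutes {0..<n-1}. signof p * (\<Prod>k = 0..<n-1. X $$ e k (p k))))"
    proof (intro continuous_map_real_mult continuous_map_sum continuous_map_prod)
      fix p k assume pk: "p \<in> {p. p permutes {0..<n-1}}" "k \<in> {0..<n-1}"
      then have "p k \<in> {0..<n-1}" using permutes_in_image[of p "{0..<n-1}" k] by simp
      then show "continuous_map T euclideanreal (\<lambda>X. X $$ e k (p k))"
        using continuous_map_mat_entry[OF T e[of k "p k"]] pk by simp
    qed (auto simp: finite_permutations)
    then show ?thesis
    proof (rule continuous_map_eq)
      fix X assume "X \<in> topspace T"
      then have X: "X \<in> carrier_mat n n" by (simp add: topT)
      have ent: "mat_delete X j i $$ (k, p k) = X $$ e k (p k)"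
        if "p permutes {0..<n-1}" "k < n - 1" for p k
      proof -
        have "p k \<in> {0..<n-1}" using permutes_in_image[OF that(1), of k] that(2) by simp
        then show ?thesis using that X by (simp add: mat_delete_def e_def)
      qed
      show "(-1) ^ (j + i) * (\<Sum>p | p permutes {0..<n-1}. signof p * (\<Prod>k = 0..<n-1. X $$ e k (p k)))
          = adj_mat X $$ (i, j)"
        using X ij mat_delete_carrier[OF X, of j i]
        by (auto simp: adj_mat_def cofactor_def det_def'[of _ "n-1"] ent intro!: sum.cong prod.cong)
    qed
  qed
  have "continuous_map T (mat_topology n) (\<lambda>X. inv\<^bsub>\<N> n\<^esub> X)"
  proof (rule continuous_map_into_mat_topology)
    fix X assume "X \<in> topspace T"
    then show "inv\<^bsub>\<N> n\<^esub> X \<in> carrier_mat n n" using N.inv_closed[of X] unfolding topT by simp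
  next
    fix i j assume "i < n" "j < n"
    from entry[OF this] show "continuous_map T euclideanreal (\<lambda>X. (inv\<^bsub>\<N> n\<^esub> X) $$ (i, j))"
      by (rule continuous_map_eq) (simp only: topT inv_eq)
  qed
  moreover have "(\<lambda>X. inv\<^bsub>\<N> n\<^esub> X) \<in> topspace T \<rightarrow> carrier (\<N> n)"
    unfolding topT using N.inv_closed by blast
  ultimately show ?thesis
    by (subst (2) T_def, unfold continuous_map_in_subtopology) auto
qed

lemma coarse_structure_unipotent_coarse:
  "coarse_structure (carrier (\<N> n)) (unipotent_coarse n)"
proof (rule coarse_structure_LR_coarse)
  interpret N: group "\<N> n" by (rule group_unipotent_group)
  let ?T = "subtopology (mat_topology n) (carrier (\<N> n))"
  let ?P = "prod_topology ?T ?T"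
  show topT: "topspace ?T = carrier (\<N> n)" by auto
  have id: "continuous_map ?T (mat_topology n) (\<lambda>X. X)"
    by (simp add: continuous_map_from_subtopology)
  have c: "continuous_map ?P (mat_topology n) fst" "continuous_map ?P (mat_topology n) snd"
    using continuous_map_compose[OF continuous_map_fst id]
      continuous_map_compose[OF continuous_map_snd id] by (simp_all add: o_def)
  have "continuous_map ?P (mat_topology n) (\<lambda>p. fst p * snd p)"
  proof (rule continuous_map_into_mat_topology)
    fix i j assume ij: "i < n" "j < n"
    have "continuous_map ?P euclideanreal (\<lambda>p. \<Sum>k<n. fst p $$ (i, k) * snd p $$ (k, j))"
      using ij by (intro continuous_map_sum continuous_map_real_mult
          continuous_map_mat_entry[OF c(1)] continuous_map_mat_entry[OF c(2)]) auto
    then show "continuous_map ?P euclideanreal (\<lambda>p. (fst p * snd p) $$ (i, j))"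
      by (rule continuous_map_eq) (use ij in \<open>auto simp: index_mult_upper simp del: index_mult_mat\<close>)
  qed (auto intro!: mult_carrier_mat)
  moreover have "(\<lambda>p. fst p * snd p) \<in> topspace ?P \<rightarrow> carrier (\<N> n)"
    unfolding topspace_prod_topology topT using N.m_closed by fastforce
  ultimately have "continuous_map ?P ?T (\<lambda>p. fst p * snd p)"
    unfolding continuous_map_in_subtopology by auto
  then show "continuous_map ?P ?T (\<lambda>(X, Y). X \<otimes>\<^bsub>\<N> n\<^esub> Y)"
    by (simp add: case_prod_unfold)
qed (rule group_unipotent_group continuous_map_unipotent_inverse)+

lemma lex_subsets:
  "set ` set (lex_subsets m q) = {I. I \<subseteq> {0..<m} \<and> card I = q}"
  "sorted_wrt (\<lambda>I J. (I, J) \<in> lexord {(a, b). a < b}) (lex_subsets m q)"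
proof -
  have d: "distinct I" if "I \<in> set (subseqs [0..<m])" for I
    using subseqs_distinctD[OF that] by simp
  have "set ` set (lex_subsets m q) = {I \<in> set ` set (subseqs [0..<m]). card I = q}"
    unfolding lex_subsets_def using d distinct_card by (fastforce simp: image_iff)
  then show "set ` set (lex_subsets m q) = {I. I \<subseteq> {0..<m} \<and> card I = q}"
    by (auto simp: subseqs_powset)
  have "sorted_wrt (\<lambda>I J. (I, J) \<in> lexord {(a, b). a < b}) (filter (\<lambda>I. length I = q) (subseqs xs))"
    if "sorted_wrt (<) xs" for xs :: "nat list"
    using that
  proof (induction xs arbitrary: q)
    case (Cons x xs)
    have f: "filter (\<lambda>I. length I = q) (map ((#) x) ys) =
        (if q = 0 then [] else map ((#) x) (filter (\<lambda>I. length I = q - 1) ys))" for ys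
      by (induction ys) auto
    have hd: "hd J \<in> set xs" if "J \<in> set (subseqs xs)" "J \<noteq> []" for J
      using that hd_in_set[of J] subseqs_powset[of xs] by blast
    then have "(x # I, J) \<in> lexord {(a, b). a < b}"
      if "J \<in> set (subseqs xs)" "J \<noteq> []" for I J
      using hd[OF that] that Cons.prems by (cases J) auto
    then show ?case
      using Cons by (auto simp: Let_def f sorted_wrt_append sorted_wrt_map)
  qed simp
  then show "sorted_wrt (\<lambda>I J. (I, J) \<in> lexord {(a, b). a < b}) (lex_subsets m q)"
    by (simp add: lex_subsets_def)
qed

end

theory Submission
  imports Defs
begin

text \<open>If \<open>X = A Y C\<close> with \<open>A\<close>, \<open>C\<close> in a compact subset of \<open>\<N> n\<close>, then
  \<open>\<Phi>\<^sub>i\<^sub>j\<close> and \<open>\<And>\<^sup>q\<close> are multiplicative on triangular matrices, so the norms of the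
  compound matrices of \<open>X\<close> and \<open>Y\<close> differ at most by a constant factor, and their logarithms by
  an additive constant. Only this inequality is needed, not the Cauchy-Binet formula: a minor of a
  product is expanded over all row selections, injective or not, and each of the resulting
  generalised minors is zero or a signed ordinary minor. The map \<open>\<alpha> i\<close> with \<open>i \<ge> 1\<close> is a
  homomorphism to the reals. Since \<open>\<alpha> 0\<close> is proper, so is every tuple of controlled maps that
  contains it.\<close>

section \<open>Minors with arbitrary row and column selections\<close>

text \<open>Selections are functions rather than sets, so repeated and unsorted indices are allowed;
  expanding a product of matrices produces exactly such selections. Only the first \<open>q\<close>
  values of \<open>r\<close> and \<open>s\<close> matter.\<close>

definition gen_minor :: "nat \<Rightarrow> real mat \<Rightarrow> (nat \<Rightarrow> nat) \<Rightarrow> (nat \<Rightarrow> nat) \<Rightarrow> real" where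
  "gen_minor q A r s = det (mat q q (\<lambda>(a, b). A $$ (r a, s b)))"

text \<open>Transfers facts about rows to columns. The ranges of \<open>r\<close> and
  \<open>s\<close> keep all indices inside the matrix, where the entries of the transpose are
  specified.\<close>

lemma gen_minor_transpose:
  assumes "A \<in> carrier_mat m m" "r \<in> {0..<q} \<rightarrow> {0..<m}" "s \<in> {0..<q} \<rightarrow> {0..<m}"
  shows "gen_minor q (transpose_mat A) r s = gen_minor q A s r"
proof -
  have "mat q q (\<lambda>(a, b). transpose_mat A $$ (r a, s b)) =
      transpose_mat (mat q q (\<lambda>(a, b). A $$ (s a, r b)))"
    by (rule eq_matI) (use assms in \<open>auto simp: Pi_iff\<close>)
  then show ?thesis
    unfolding gen_minor_def by (metis det_transpose mat_carrier)
qed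

lemma gen_minor_expand:
  "gen_minor q A r s =
     (\<Sum>p | p permutes {0..<q}. signof p * (\<Prod>a = 0..<q. A $$ (r a, s (p a))))"
proof -
  have "p a < q" if "p permutes {0..<q}" "a < q" for p a
    using permutes_in_image[OF that(1), of a] that(2) by simp
  then show ?thesis
    unfolding gen_minor_def by (subst det_def'[of _ q]) (auto intro!: sum.cong prod.cong)
qed

text \<open>Each row of \<open>A * B\<close> is a combination of rows of \<open>B\<close>, and the
  determinant is multilinear in its rows. Grouping the maps \<open>f\<close> by their image would
  give the Cauchy-Binet formula.\<close>

lemma gen_minor_mult:
  assumes A: "A \<in> carrier_mat m m" and B: "B \<in> carrier_mat m m"
    and r: "r \<in> {0..<q} \<rightarrow> {0..<m}" and s: "s \<in> {0..<q} \<rightarrow> {0..<m}"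
  shows "gen_minor q (A * B) r s =
     (\<Sum>f\<in>{0..<q} \<rightarrow>\<^sub>E {..<m}. (\<Prod>a = 0..<q. A $$ (r a, f a)) * gen_minor q B f s)"
proof -
  have *: "(\<Prod>a = 0..<q. (A * B) $$ (r a, s (p a))) =
     (\<Sum>f\<in>{0..<q} \<rightarrow>\<^sub>E {..<m}. (\<Prod>a = 0..<q. A $$ (r a, f a)) * (\<Prod>a = 0..<q. B $$ (f a, s (p a))))"
    if p: "p permutes {0..<q}" for p
  proof -
    have "p a < q" if "a < q" for a using permutes_in_image[OF p, of a] that by simp
    then have "(\<Prod>a = 0..<q. (A * B) $$ (r a, s (p a))) =
       (\<Prod>a = 0..<q. \<Sum>k<m. A $$ (r a, k) * B $$ (k, s (p a)))"
      using r s by (intro prod.cong index_mult_upper[OF A B]) (auto simp: Pi_iff)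
    \<comment> \<open>A product of sums is a sum over all ways \<open>f\<close> to choose one
      summand from each factor.\<close>
    also have "\<dots> = (\<Sum>f\<in>{0..<q} \<rightarrow>\<^sub>E {..<m}. \<Prod>a = 0..<q. A $$ (r a, f a) * B $$ (f a, s (p a)))"
      by (rule prod_sum_PiE) auto
    finally show ?thesis by (simp add: prod.distrib)
  qed
  have "gen_minor q (A * B) r s = (\<Sum>p | p permutes {0..<q}. \<Sum>f\<in>{0..<q} \<rightarrow>\<^sub>E {..<m}.
      (\<Prod>a = 0..<q. A $$ (r a, f a)) * (signof p * (\<Prod>a = 0..<q. B $$ (f a, s (p a)))))"
    unfolding gen_minor_expand
    by (rule sum.cong) (auto simp: * sum_distrib_left mult_ac simp del: index_mult_mat)
  \<comment> \<open>With \<open>f\<close> outside, the inner sum over \<open>p\<close> is the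
    Leibniz expansion of the minor of \<open>B\<close> with rows \<open>f\<close>.\<close>
  also have "\<dots> = (\<Sum>f\<in>{0..<q} \<rightarrow>\<^sub>E {..<m}. \<Sum>p | p permutes {0..<q}.
      (\<Prod>a = 0..<q. A $$ (r a, f a)) * (signof p * (\<Prod>a = 0..<q. B $$ (f a, s (p a)))))"
    by (rule sum.swap)
  finally show ?thesis
    by (simp add: gen_minor_expand sum_distrib_left)
qed

text \<open>There are \<open>m ^ q\<close> selections \<open>f\<close> in the expansion, each with a
  weight of absolute value at most \<open>R ^ q\<close>.\<close>

lemma abs_gen_minor_mult_le:
  assumes A: "A \<in> carrier_mat m m" and B: "B \<in> carrier_mat m m"
    and R: "\<And>i j. i < m \<Longrightarrow> j < m \<Longrightarrow> \<bar>A $$ (i, j)\<bar> \<le> R"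
    and M: "\<And>f g. f \<in> {0..<q} \<rightarrow> {0..<m} \<Longrightarrow> g \<in> {0..<q} \<rightarrow> {0..<m} \<Longrightarrow> \<bar>gen_minor q B f g\<bar> \<le> M"
    and r: "r \<in> {0..<q} \<rightarrow> {0..<m}" and s: "s \<in> {0..<q} \<rightarrow> {0..<m}"
  shows "\<bar>gen_minor q (A * B) r s\<bar> \<le> (real m * R) ^ q * M"
proof -
  have "\<bar>gen_minor q (A * B) r s\<bar> \<le>
     (\<Sum>f\<in>{0..<q} \<rightarrow>\<^sub>E {..<m}. \<bar>(\<Prod>a = 0..<q. A $$ (r a, f a)) * gen_minor q B f s\<bar>)"
    unfolding gen_minor_mult[OF A B r s] by (rule sum_abs)
  also have "\<dots> \<le> (\<Sum>f\<in>{0..<q} \<rightarrow>\<^sub>E {..<m}. R ^ q * M)"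
  proof (rule sum_mono)
    fix f assume f: "f \<in> {0..<q} \<rightarrow>\<^sub>E {..<m}"
    have "(\<Prod>a = 0..<q. \<bar>A $$ (r a, f a)\<bar>) \<le> (\<Prod>a = 0..<q. R)"
      using f r by (intro prod_mono) (auto intro!: R simp: PiE_iff Pi_iff)
    moreover have "\<bar>gen_minor q B f s\<bar> \<le> M"
      using f s by (intro M) (auto simp: PiE_iff Pi_iff)
    \<comment> \<open>The signs of \<open>R\<close> and \<open>M\<close> are not given, so
      monotonicity is used in the form that asks for nonnegativity of the two smaller factors, here
      absolute values.\<close>
    ultimately have "(\<Prod>a = 0..<q. \<bar>A $$ (r a, f a)\<bar>) * \<bar>gen_minor q B f s\<bar> \<le> R ^ q * M"
      by (intro mult_mono') (auto intro: prod_nonneg)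
    then show "\<bar>(\<Prod>a = 0..<q. A $$ (r a, f a)) * gen_minor q B f s\<bar> \<le> R ^ q * M"
      by (simp add: abs_mult abs_prod)
  qed
  also have "\<dots> = (real m * R) ^ q * M"
    by (simp add: card_PiE power_mult_distrib)
  finally show ?thesis .
qed

text \<open>Multiplication by \<open>C\<close> on the right becomes multiplication by its transpose
  on the left, so the one-sided bound applies twice: first to \<open>A * B\<close>, then to the
  transposed product.\<close>

lemma abs_gen_minor_mult_mult_le:
  assumes A: "A \<in> carrier_mat m m" and B: "B \<in> carrier_mat m m" and C: "C \<in> carrier_mat m m"
    and RA: "\<And>i j. i < m \<Longrightarrow> j < m \<Longrightarrow> \<bar>A $$ (i, j)\<bar> \<le> R"
    and RC: "\<And>i j. i < m \<Longrightarrow> j < m \<Longrightarrow> \<bar>C $$ (i, j)\<bar> \<le> R"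
    and M: "\<And>f g. f \<in> {0..<q} \<rightarrow> {0..<m} \<Longrightarrow> g \<in> {0..<q} \<rightarrow> {0..<m} \<Longrightarrow> \<bar>gen_minor q B f g\<bar> \<le> M"
    and r: "r \<in> {0..<q} \<rightarrow> {0..<m}" and s: "s \<in> {0..<q} \<rightarrow> {0..<m}"
  shows "\<bar>gen_minor q (A * B * C) r s\<bar> \<le> (real m * R) ^ q * ((real m * R) ^ q * M)"
proof -
  have AB: "A * B \<in> carrier_mat m m" using A B by simp
  have tr: "transpose_mat (A * B * C) = transpose_mat C * transpose_mat (A * B)"
    by (rule transpose_mult[OF AB C])
  have "\<bar>gen_minor q (transpose_mat C * transpose_mat (A * B)) s r\<bar>
      \<le> (real m * R) ^ q * ((real m * R) ^ q * M)"
  proof (rule abs_gen_minor_mult_le[where m = m])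
    fix f g assume fg: "f \<in> {0..<q} \<rightarrow> {0..<m}" "g \<in> {0..<q} \<rightarrow> {0..<m}"
    show "\<bar>gen_minor q (transpose_mat (A * B)) f g\<bar> \<le> (real m * R) ^ q * M"
      unfolding gen_minor_transpose[OF AB fg]
      by (rule abs_gen_minor_mult_le[OF A B RA M fg(2,1)])
  qed (use AB C r s RC in auto)
  then show ?thesis
    unfolding tr[symmetric] using gen_minor_transpose[of "A * B * C" m s q r] AB C r s by simp
qed

text \<open>An injective selection is a permutation of the increasing enumeration
  \<open>pick\<close> of its image, and permuting rows changes a determinant by a sign only.\<close>

lemma gen_minor_sorted_rows:
  assumes r: "inj_on r {0..<q}"
  shows "\<bar>gen_minor q A r s\<bar> = \<bar>gen_minor q A (pick (r ` {0..<q})) s\<bar>"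
proof -
  define I where "I = r ` {0..<q}"
  have I: "finite I" "card I = q" using r by (auto simp: I_def card_image)
  \<comment> \<open>\<open>p a\<close> is the rank of \<open>r a\<close> within the image
    \<open>I\<close>; beyond \<open>q\<close> it is the identity, as \<open>permutes\<close>
    demands.\<close>
  define p where "p a = (if a < q then card {x \<in> I. x < r a} else a)" for a
  have pk: "pick I (p a) = r a" if "a < q" for a
    using that pick_card_in_set[of "r a" I] by (auto simp: p_def I_def)
  have pq: "p a < q" if "a < q" for a
  proof -
    have "{x \<in> I. x < r a} \<subset> I" using that by (auto simp: I_def)
    then show ?thesis using that I psubset_card_mono[of I] by (simp add: p_def)
  qed
  have inj: "inj_on p {0..<q}"
  proof (rule inj_onI)
    fix a b assume "a \<in> {0..<q}" "b \<in> {0..<q}" "p a = p b"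
    then show "a = b" using pk[of a] pk[of b] inj_onD[OF r] by simp
  qed
  have "p ` {0..<q} \<subseteq> {0..<q}" using pq by auto
  then have "p ` {0..<q} = {0..<q}" using inj by (simp add: endo_inj_surj)
  then have perm: "p permutes {0..<q}"
    using inj by (intro bij_imp_permutes) (auto simp: bij_betw_def p_def)
  define B where "B = mat q q (\<lambda>(a, b). A $$ (pick I a, s b))"
  have "mat q q (\<lambda>(a, b). A $$ (r a, s b)) = mat q q (\<lambda>(a, b). B $$ (p a, b))"
    using pk pq by (intro cong_mat) (auto simp: B_def)
  then have "gen_minor q A r s = signof p * gen_minor q A (pick I) s"
    unfolding gen_minor_def using det_permute_rows[OF _ perm, of B] by (simp add: B_def)
  then show ?thesis by (simp add: abs_mult I_def sign_def)
qed

lemma gen_minor_not_inj: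
  assumes "\<not> inj_on r {0..<q}"
  shows "gen_minor q A r s = 0"
proof -
  obtain a b where ab: "a < q" "b < q" "a \<noteq> b" "r a = r b"
    using assms by (auto simp: inj_on_def)
  show ?thesis
    unfolding gen_minor_def
    by (rule det_identical_rows[OF mat_carrier ab(3,1,2)]) (use ab in \<open>auto intro!: eq_vecI\<close>)
qed


section \<open>Norms of compound matrices\<close>

text \<open>Nonemptiness excludes \<open>Max {}\<close>, whose value is unspecified.\<close>

lemma mat_norm_le_iff:
  assumes "elements_mat A \<noteq> {}"
  shows "mat_norm A \<le> c \<longleftrightarrow> (\<forall>x\<in>elements_mat A. \<bar>x\<bar> \<le> c)"
proof -
  have "finite (elements_mat A)" by (simp add: elements_mat_def)
  then show ?thesis using assms by (simp add: mat_norm_def)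
qed

lemma abs_le_mat_norm: "x \<in> elements_mat A \<Longrightarrow> \<bar>x\<bar> \<le> mat_norm A"
  using mat_norm_le_iff[of A "mat_norm A"] by auto

lemma elements_mat_eq: "elements_mat A = {A $$ (i, j) | i j. i < dim_row A \<and> j < dim_col A}"
proof (intro Set.set_eqI iffI)
  fix x assume "x \<in> elements_mat A"
  then show "x \<in> {A $$ (i, j) | i j. i < dim_row A \<and> j < dim_col A}" by blast
qed auto

text \<open>The norm depends only on the set of entries, so from here on the lexicographic order is
  irrelevant. The enumeration \<open>pick\<close> appears because \<open>submatrix\<close> uses it
  to number the chosen rows and columns.\<close>

lemma elements_ext_power:
  assumes A: "A \<in> carrier_mat m m"
  shows "elements_mat (ext_power q A) =
    {gen_minor q A (pick I) (pick J) | I J. I \<subseteq> {0..<m} \<and> card I = q \<and> J \<subseteq> {0..<m} \<and> card J = q}"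
    (is "?L = ?R")
proof -
  let ?Is = "lex_subsets m q"
  have sub: "det (submatrix A I J) = gen_minor q A (pick I) (pick J)"
    if "I \<subseteq> {0..<m}" "card I = q" "J \<subseteq> {0..<m}" "card J = q" for I J
  proof -
    have "{i. i < m \<and> i \<in> I} = I" "{i. i < m \<and> i \<in> J} = J" using that by auto
    then show ?thesis using A that by (simp add: submatrix_def gen_minor_def)
  qed
  have "?L = {det (submatrix A (set (?Is ! a)) (set (?Is ! b))) | a b. a < length ?Is \<and> b < length ?Is}"
  proof -
    have ext: "ext_power q A = mat (length ?Is) (length ?Is)
        (\<lambda>(a, b). det (submatrix A (set (?Is ! a)) (set (?Is ! b))))"
      using A by (simp add: ext_power_def Let_def)
    show ?thesis unfolding elements_mat_eq ext by (intro Collect_cong) force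
  qed
  also have "\<dots> = {det (submatrix A (set I) (set J)) | I J. I \<in> set ?Is \<and> J \<in> set ?Is}"
    unfolding in_set_conv_nth by blast
  also have "\<dots> = {det (submatrix A I J) | I J. I \<in> set ` set ?Is \<and> J \<in> set ` set ?Is}"
    by blast
  also have "\<dots> = ?R"
    unfolding lex_subsets(1) by (intro Collect_cong iff_exI) (auto simp: sub)
  finally show ?thesis .
qed

lemma gen_minor_in_elements_ext_power:
  assumes "A \<in> carrier_mat m m" "I \<subseteq> {0..<m}" "card I = q" "J \<subseteq> {0..<m}" "card J = q"
  shows "gen_minor q A (pick I) (pick J) \<in> elements_mat (ext_power q A)"
  unfolding elements_ext_power[OF assms(1)] using assms by blast

text \<open>For injective selections, sorting the rows and then, through the transpose, the columns
  leads to an entry of the compound matrix. A repeated row or column makes the minor zero.\<close>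

lemma abs_gen_minor_le_mat_norm_ext_power:
  assumes A: "A \<in> carrier_mat m m" and r: "r \<in> {0..<q} \<rightarrow> {0..<m}" and s: "s \<in> {0..<q} \<rightarrow> {0..<m}"
    and q: "q \<le> m"
  shows "\<bar>gen_minor q A r s\<bar> \<le> mat_norm (ext_power q A)"
proof (cases "inj_on r {0..<q} \<and> inj_on s {0..<q}")
  case True
  define I J where "I = r ` {0..<q}" and "J = s ` {0..<q}"
  have IJ: "I \<subseteq> {0..<m}" "card I = q" "J \<subseteq> {0..<m}" "card J = q"
    using r s True by (auto simp: I_def J_def card_image)
  have pI: "pick I \<in> {0..<q} \<rightarrow> {0..<m}"
    using IJ pick_in_set_le[of _ I] by auto
  have pJ: "pick J \<in> {0..<q} \<rightarrow> {0..<m}"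
    using IJ pick_in_set_le[of _ J] by auto
  have "\<bar>gen_minor q A r s\<bar> = \<bar>gen_minor q A (pick I) s\<bar>"
    using gen_minor_sorted_rows[of r q A s] True by (simp add: I_def)
  also have "\<dots> = \<bar>gen_minor q (transpose_mat A) s (pick I)\<bar>"
    using gen_minor_transpose[OF A s pI] by simp
  also have "\<dots> = \<bar>gen_minor q (transpose_mat A) (pick J) (pick I)\<bar>"
    using gen_minor_sorted_rows[of s q] True by (simp add: J_def)
  also have "\<dots> = \<bar>gen_minor q A (pick I) (pick J)\<bar>"
    using gen_minor_transpose[OF A pJ pI] by simp
  also have "\<dots> \<le> mat_norm (ext_power q A)"
    by (intro abs_le_mat_norm gen_minor_in_elements_ext_power[OF A] IJ)
  finally show ?thesis .
next
  case False
  then have "gen_minor q A r s = 0"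
    using gen_minor_not_inj[of r q A s] gen_minor_not_inj[of s q "transpose_mat A" r]
      gen_minor_transpose[OF A s r] by auto
  \<comment> \<open>The leading minor is an entry because \<open>q \<le> m\<close>; its absolute
    value shows that the norm is nonnegative.\<close>
  moreover have "\<bar>gen_minor q A (pick {0..<q}) (pick {0..<q})\<bar> \<le> mat_norm (ext_power q A)"
    using q by (intro abs_le_mat_norm gen_minor_in_elements_ext_power[OF A]) auto
  ultimately show ?thesis by simp
qed

text \<open>The central estimate: the factor in front of the norm for \<open>B\<close> depends only
  on \<open>m\<close>, \<open>q\<close> and \<open>R\<close>. The norm itself serves as the bound
  \<open>M\<close> on the generalised minors of \<open>B\<close>.\<close>

lemma mat_norm_ext_power_mult_mult_le:
  assumes A: "A \<in> carrier_mat m m" and B: "B \<in> carrier_mat m m" and C: "C \<in> carrier_mat m m"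
    and RA: "\<And>i j. i < m \<Longrightarrow> j < m \<Longrightarrow> \<bar>A $$ (i, j)\<bar> \<le> R"
    and RC: "\<And>i j. i < m \<Longrightarrow> j < m \<Longrightarrow> \<bar>C $$ (i, j)\<bar> \<le> R"
    and q: "q \<le> m"
  shows "mat_norm (ext_power q (A * B * C)) \<le>
     (real m * R) ^ q * ((real m * R) ^ q * mat_norm (ext_power q B))"
proof -
  have ABC: "A * B * C \<in> carrier_mat m m" using A B C by simp
  have "gen_minor q (A * B * C) (pick {0..<q}) (pick {0..<q}) \<in> elements_mat (ext_power q (A * B * C))"
    using q by (intro gen_minor_in_elements_ext_power[OF ABC]) auto
  then have "elements_mat (ext_power q (A * B * C)) \<noteq> {}" by blast
  moreover have "\<bar>gen_minor q (A * B * C) (pick I) (pick J)\<bar>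
      \<le> (real m * R) ^ q * ((real m * R) ^ q * mat_norm (ext_power q B))"
    if "I \<subseteq> {0..<m}" "card I = q" "J \<subseteq> {0..<m}" "card J = q" for I J
    using that pick_in_set_le[of _ I] pick_in_set_le[of _ J]
    by (intro abs_gen_minor_mult_mult_le A B C RA RC
        abs_gen_minor_le_mat_norm_ext_power[OF B _ _ q]) auto
  ultimately show ?thesis
    by (subst mat_norm_le_iff) (auto simp: elements_ext_power[OF ABC])
qed

lemma pick_atLeastLessThan:
  assumes "a < v - u"
  shows "pick {u..<v} a = u + a"
  using assms
proof (induction a)
  case 0
  then show ?case by (auto intro!: Least_equality)
next
  case (Suc a)
  then have "pick {u..<v} a = u + a" by simp
  then show ?case using Suc.prems by (auto intro!: Least_equality)
qed

text \<open>The leading principal minor of size \<open>q\<close> equals 1. This keeps the arguments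
  of the logarithms positive.\<close>

lemma mat_norm_ext_power_unitriangular_ge_1:
  assumes A: "A \<in> carrier_mat m m" "upper_triangular A" "\<forall>i<m. A $$ (i, i) = 1" and q: "q \<le> m"
  shows "1 \<le> mat_norm (ext_power q A)"
proof -
  let ?B = "mat q q (\<lambda>(a, b). A $$ (a, b))"
  have "diag_mat ?B = replicate q 1"
    using A q by (auto simp: diag_mat_def intro!: nth_equalityI)
  moreover have "upper_triangular ?B"
  proof
    fix i j assume "j < i" "i < dim_row ?B"
    then show "?B $$ (i, j) = 0" using A q upper_triangularD[of A j i] by simp
  qed
  ultimately have "gen_minor q A (\<lambda>a. a) (\<lambda>a. a) = 1"
    unfolding gen_minor_def using det_upper_triangular[of ?B q] by simp
  then show ?thesis
    using abs_gen_minor_le_mat_norm_ext_power[OF A(1), of "\<lambda>a. a" q "\<lambda>a. a"] q by auto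
qed

text \<open>Minors of size 1 are entries. Together with \<open>block_full\<close> this makes
  \<open>\<alpha> 0\<close> an instance of \<open>\<mu>\<close>.\<close>

lemma elements_ext_power_1:
  assumes A: "A \<in> carrier_mat m m"
  shows "elements_mat (ext_power 1 A) = elements_mat A"
proof -
  have pick_0: "pick {i} 0 = i" for i by (auto intro: Least_equality)
  have 1: "gen_minor 1 A (pick {i}) (pick {j}) = A $$ (i, j)" for i j
    unfolding gen_minor_def by (subst det_single) (auto simp: pick_0 simp del: pick.simps)
  have "elements_mat (ext_power 1 A) = {A $$ (i, j) | i j. i < m \<and> j < m}"
    (is "?L = ?R")
  proof (intro Set.set_eqI iffI)
    fix x assume "x \<in> ?L"
    then obtain I J where IJ: "x = gen_minor 1 A (pick I) (pick J)"
      "I \<subseteq> {0..<m}" "card I = 1" "J \<subseteq> {0..<m}" "card J = 1"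
      unfolding elements_ext_power[OF A] by blast
    from IJ(3,5) obtain i j where "I = {i}" "J = {j}" by (metis card_1_singletonE)
    then show "x \<in> ?R" using IJ 1 by auto
  next
    fix x assume "x \<in> ?R"
    then obtain i j where ij: "x = A $$ (i, j)" "i < m" "j < m" by blast
    then have "gen_minor 1 A (pick {i}) (pick {j}) \<in> ?L"
      by (intro gen_minor_in_elements_ext_power[OF A]) auto
    then show "x \<in> ?L" using 1 ij by simp
  qed
  also have "\<dots> = elements_mat A"
    using A by (simp add: elements_mat_eq)
  finally show ?thesis .
qed

section \<open>Consecutive principal blocks of triangular matrices\<close>

text \<open>The size is written \<open>j - (i - 1)\<close>, not \<open>j - i + 1\<close>, so that
  truncated subtraction gives the length of the index interval even if \<open>j < i\<close>.\<close>

lemma block_eq: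
  assumes "A \<in> carrier_mat n n" "1 \<le> i" "j \<le> n"
  shows "\<Phi> i j A = mat (j - (i - 1)) (j - (i - 1)) (\<lambda>(a, b). A $$ (i - 1 + a, i - 1 + b))"
proof -
  have "{k. k < n \<and> k \<in> {i - 1..<j}} = {i - 1..<j}" using assms by auto
  then have card: "card {k. k < dim_row A \<and> k \<in> {i - 1..<j}} = j - (i - 1)"
    "card {k. k < dim_col A \<and> k \<in> {i - 1..<j}} = j - (i - 1)"
    using assms by simp_all
  show ?thesis
    unfolding block_def submatrix_def card by (rule cong_mat) (simp_all add: pick_atLeastLessThan)
qed

text \<open>In the sum for an entry of \<open>A * B\<close> inside the block, an index
  \<open>k\<close> outside the block lies either left of the diagonal in the row of \<open>A\<close>
  or below it in the column of \<open>B\<close>, so its term vanishes.\<close>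

lemma block_mult:
  assumes A: "A \<in> carrier_mat n n" "upper_triangular A" and B: "B \<in> carrier_mat n n" "upper_triangular B"
    and i: "1 \<le> i" "j \<le> n"
  shows "\<Phi> i j (A * B) = \<Phi> i j A * \<Phi> i j B"
proof (rule eq_matI)
  let ?m = "j - (i - 1)" and ?o = "i - 1"
  have c: "\<Phi> i j A \<in> carrier_mat ?m ?m" "\<Phi> i j B \<in> carrier_mat ?m ?m"
    "\<Phi> i j (A * B) \<in> carrier_mat ?m ?m"
    using block_eq[OF _ i] A B by auto
  then show "dim_row (\<Phi> i j (A * B)) = dim_row (\<Phi> i j A * \<Phi> i j B)"
    "dim_col (\<Phi> i j (A * B)) = dim_col (\<Phi> i j A * \<Phi> i j B)" by auto
  have ent: "\<Phi> i j X $$ (a, b) = X $$ (?o + a, ?o + b)"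
    if "X \<in> carrier_mat n n" "a < ?m" "b < ?m" for X a b
    using that by (simp add: block_eq[OF _ i])
  fix a b assume "a < dim_row (\<Phi> i j A * \<Phi> i j B)" "b < dim_col (\<Phi> i j A * \<Phi> i j B)"
  then have ab: "a < ?m" "b < ?m" using c by auto
  then have abn: "?o + a < n" "?o + b < n" using i by auto
  have "\<Phi> i j (A * B) $$ (a, b) = (A * B) $$ (?o + a, ?o + b)"
    using ab A B by (intro ent) auto
  also have "\<dots> = (\<Sum>k<n. A $$ (?o + a, k) * B $$ (k, ?o + b))"
    by (rule index_mult_upper[OF A(1) B(1) abn])
  also have "\<dots> = (\<Sum>k\<in>{?o..<j}. A $$ (?o + a, k) * B $$ (k, ?o + b))"
  proof (rule sum.mono_neutral_right)
    show "\<forall>k\<in>{..<n} - {?o..<j}. A $$ (?o + a, k) * B $$ (k, ?o + b) = 0"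
    proof
      fix k assume "k \<in> {..<n} - {?o..<j}"
      then consider "k < ?o + a" | "?o + b < k" "k < n" using ab by fastforce
      then show "A $$ (?o + a, k) * B $$ (k, ?o + b) = 0"
        using A(1) B(1) abn upper_triangularD[OF A(2), of k "?o + a"]
          upper_triangularD[OF B(2), of "?o + b" k] by cases auto
    qed
  qed (use i in auto)
  also have "\<dots> = (\<Sum>k<?m. A $$ (?o + a, ?o + k) * B $$ (?o + k, ?o + b))"
    by (rule sum.reindex_bij_witness[of _ "\<lambda>k. ?o + k" "\<lambda>k. k - ?o"]) auto
  also have "\<dots> = (\<Sum>k<?m. \<Phi> i j A $$ (a, k) * \<Phi> i j B $$ (k, b))"
    using ab A B by (simp add: ent)
  also have "\<dots> = (\<Phi> i j A * \<Phi> i j B) $$ (a, b)"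
    by (rule index_mult_upper[OF c(1,2) ab, symmetric])
  finally show "\<Phi> i j (A * B) $$ (a, b) = (\<Phi> i j A * \<Phi> i j B) $$ (a, b)" .
qed


lemma block_carrier_mat:
  assumes "A \<in> carrier_mat n n" "1 \<le> i" "j \<le> n"
  shows "\<Phi> i j A \<in> carrier_mat (j - (i - 1)) (j - (i - 1))"
  using assms by (simp add: block_eq)

lemma block_unitriangular:
  assumes A: "A \<in> carrier_mat n n" "upper_triangular A" "\<forall>k<n. A $$ (k, k) = 1"
    and i: "1 \<le> i" "j \<le> n"
  shows "upper_triangular (\<Phi> i j A)" "\<forall>k<j - (i - 1). \<Phi> i j A $$ (k, k) = 1"
proof -
  show "upper_triangular (\<Phi> i j A)"
  proof
    fix a b assume "b < a" "a < dim_row (\<Phi> i j A)"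
    then show "\<Phi> i j A $$ (a, b) = 0"
      using A i upper_triangularD[OF A(2), of "i - 1 + b" "i - 1 + a"] by (simp add: block_eq[OF A(1) i])
  qed
  show "\<forall>k<j - (i - 1). \<Phi> i j A $$ (k, k) = 1"
    using A i by (simp add: block_eq[OF A(1) i])
qed

lemma block_full:
  assumes "A \<in> carrier_mat n n"
  shows "\<Phi> 1 n A = A"
  using assms by (subst block_eq[OF assms]) auto


section \<open>Bounded perturbations in the unipotent group\<close>

text \<open>The coarse structure uses inverses in \<open>\<N> n\<close>, whereas
  \<open>\<mu>\<close> uses powers in \<open>\<B> n\<close>; the two have to agree.\<close>

lemma inv_unipotent_group:
  assumes "X \<in> carrier (\<N> n)"
  shows "inv\<^bsub>\<N> n\<^esub> X = inv\<^bsub>\<B> n\<^esub> X"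
proof -
  interpret N: group "\<N> n" by (rule group_unipotent_group)
  interpret B: group "\<B> n" by (rule group_upper_group)
  have "inv\<^bsub>\<N> n\<^esub> X \<in> carrier (\<N> n)" "inv\<^bsub>\<N> n\<^esub> X \<otimes>\<^bsub>\<N> n\<^esub> X = \<one>\<^bsub>\<N> n\<^esub>"
    using N.inv_closed[OF assms] N.l_inv[OF assms] by blast+
  then have "inv\<^bsub>\<B> n\<^esub> X = inv\<^bsub>\<N> n\<^esub> X"
    using assms by (intro B.inv_equality) auto
  then show ?thesis by simp
qed

text \<open>Bounding the inverse as well makes the notion stable under inversion. This serves both
  the factor from \<open>set_inv\<close> in an entourage and the exponent -1 in
  \<open>\<mu>\<close>.\<close>

definition perturbation :: "nat \<Rightarrow> real \<Rightarrow> real mat \<Rightarrow> bool" where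
  "perturbation n R A \<longleftrightarrow> A \<in> carrier (\<N> n) \<and>
     (\<forall>i<n. \<forall>j<n. \<bar>A $$ (i, j)\<bar> \<le> R \<and> \<bar>(inv\<^bsub>\<N> n\<^esub> A) $$ (i, j)\<bar> \<le> R)"

lemma perturbation_inv:
  assumes "perturbation n R A"
  shows "perturbation n R (inv\<^bsub>\<N> n\<^esub> A)"
proof -
  interpret N: group "\<N> n" by (rule group_unipotent_group)
  have "A \<in> carrier (\<N> n)" using assms unfolding perturbation_def by blast
  then have "inv\<^bsub>\<N> n\<^esub> A \<in> carrier (\<N> n)" "inv\<^bsub>\<N> n\<^esub> (inv\<^bsub>\<N> n\<^esub> A) = A"
    by (rule N.inv_closed, rule N.inv_inv)
  then show ?thesis using assms unfolding perturbation_def by metis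
qed

text \<open>Each entry is a continuous function, hence bounded on a compact set, and there are
  finitely many entries.\<close>

lemma compactin_unipotent_entries_bounded:
  assumes C: "compactin (subtopology (mat_topology n) (carrier (\<N> n))) C"
  obtains R where "\<And>X i j. X \<in> C \<Longrightarrow> i < n \<Longrightarrow> j < n \<Longrightarrow> \<bar>X $$ (i, j)\<bar> \<le> R"
proof -
  let ?T = "subtopology (mat_topology n) (carrier (\<N> n))"
  have id: "continuous_map ?T (mat_topology n) (\<lambda>X. X)"
    by (simp add: continuous_map_from_subtopology)
  have "\<exists>b. \<forall>X\<in>C. \<bar>X $$ p\<bar> \<le> b" if p: "p \<in> {..<n} \<times> {..<n}" for p
  proof -
    obtain i j where ij: "p = (i, j)" "i < n" "j < n" using p by auto
    have "compact ((\<lambda>X. X $$ (i, j)) ` C)"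
      using image_compactin[OF C continuous_map_mat_entry[OF id ij(2,3)]] by simp
    then have "bounded ((\<lambda>X. X $$ (i, j)) ` C)" by (rule compact_imp_bounded)
    then show ?thesis unfolding ij(1) bounded_iff by auto
  qed
  then obtain b where b: "\<And>p X. p \<in> {..<n} \<times> {..<n} \<Longrightarrow> X \<in> C \<Longrightarrow> \<bar>X $$ p\<bar> \<le> b p" by metis
  show ?thesis
  proof
    fix X i j assume X: "X \<in> C" and ij: "i < n" "j < n"
    have "\<bar>X $$ (i, j)\<bar> \<le> \<bar>b (i, j)\<bar>" using b[of "(i, j)" X] X ij by auto
    \<comment> \<open>The sum of the absolute bounds over all positions serves as one bound for
      every entry.\<close>
    also have "\<dots> \<le> (\<Sum>p\<in>{..<n} \<times> {..<n}. \<bar>b p\<bar>)"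
      by (rule member_le_sum) (use ij in auto)
    finally show "\<bar>X $$ (i, j)\<bar> \<le> (\<Sum>p\<in>{..<n} \<times> {..<n}. \<bar>b p\<bar>)" .
  qed
qed

text \<open>Replaces the compact set witnessing an entourage by a single numerical bound
  \<open>R\<close>.\<close>

lemma unipotent_coarseE:
  assumes E: "E \<in> unipotent_coarse n"
  obtains R where "\<And>X Y. (X, Y) \<in> E \<Longrightarrow> X \<in> carrier (\<N> n) \<and> Y \<in> carrier (\<N> n) \<and>
    (\<exists>A C. perturbation n R A \<and> perturbation n R C \<and> X = A * Y * C)"
proof -
  interpret N: group "\<N> n" by (rule group_unipotent_group)
  let ?T = "subtopology (mat_topology n) (carrier (\<N> n))"
  obtain C where C: "compactin ?T C" and sub: "E \<subseteq> carrier (\<N> n) \<times> carrier (\<N> n)"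
    and *: "\<forall>(x, y)\<in>E. x \<in> (C #>\<^bsub>\<N> n\<^esub> y) <#>\<^bsub>\<N> n\<^esub> (set_inv\<^bsub>\<N> n\<^esub> C)"
    using E unfolding LR_coarse_def by blast
  have CN: "C \<subseteq> carrier (\<N> n)" using compactin_subset_topspace[OF C] by auto
  \<comment> \<open>Adjoining the inverses keeps the set compact, since inversion is continuous, and
    gives one \<open>R\<close> for matrices and their inverses.\<close>
  let ?D = "C \<union> (\<lambda>X. inv\<^bsub>\<N> n\<^esub> X) ` C"
  have "compactin ?T ?D"
    using C image_compactin[OF C continuous_map_unipotent_inverse] by (rule compactin_Un)
  then obtain R where R: "\<And>X i j. X \<in> ?D \<Longrightarrow> i < n \<Longrightarrow> j < n \<Longrightarrow> \<bar>X $$ (i, j)\<bar> \<le> R"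
    by (rule compactin_unipotent_entries_bounded) blast
  have pert: "perturbation n R A" if "A \<in> C" for A
    using that CN R[of A] R[of "inv\<^bsub>\<N> n\<^esub> A"] unfolding perturbation_def by blast
  show ?thesis
  proof
    fix X Y assume XY: "(X, Y) \<in> E"
    then have "X \<in> (C #>\<^bsub>\<N> n\<^esub> Y) <#>\<^bsub>\<N> n\<^esub> (set_inv\<^bsub>\<N> n\<^esub> C)" using * by blast
    then obtain A D where "A \<in> C" "D \<in> C" "X = A * Y * inv\<^bsub>\<N> n\<^esub> D"
      by (auto simp: r_coset_def set_mult_def SET_INV_def)
    then show "X \<in> carrier (\<N> n) \<and> Y \<in> carrier (\<N> n) \<and>
      (\<exists>A C. perturbation n R A \<and> perturbation n R C \<and> X = A * Y * C)"
      using XY sub pert perturbation_inv by blast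
  qed
qed

text \<open>An upper bound for \<open>f (A Y C) - f Y\<close> suffices: the lower bound is the upper bound for the
  inverse entourage.\<close>

lemma controlled_map_unipotent_coarseI:
  assumes "\<And>R. \<exists>b. \<forall>A Y C. perturbation n R A \<longrightarrow> perturbation n R C \<longrightarrow> Y \<in> carrier (\<N> n) \<longrightarrow>
      f (A * Y * C) \<le> f Y + b"
  shows "controlled_map (carrier (\<N> n)) (unipotent_coarse n) UNIV real_line_coarse f"
proof -
  have up: "\<exists>b. \<forall>(X, Y)\<in>E. f X \<le> f Y + b" if E: "E \<in> unipotent_coarse n" for E
  proof -
    obtain R where R: "\<And>X Y. (X, Y) \<in> E \<Longrightarrow> X \<in> carrier (\<N> n) \<and> Y \<in> carrier (\<N> n) \<and>
      (\<exists>A C. perturbation n R A \<and> perturbation n R C \<and> X = A * Y * C)"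
      by (rule unipotent_coarseE[OF E]) blast
    obtain b where "\<forall>A Y C. perturbation n R A \<longrightarrow> perturbation n R C \<longrightarrow> Y \<in> carrier (\<N> n) \<longrightarrow>
      f (A * Y * C) \<le> f Y + b" using assms by blast
    then have "\<forall>(X, Y)\<in>E. f X \<le> f Y + b" using R by blast
    then show ?thesis by blast
  qed
  have "{(f X, f Y) | X Y. (X, Y) \<in> E} \<in> real_line_coarse" if E: "E \<in> unipotent_coarse n" for E
  proof -
    have "E\<inverse> \<in> unipotent_coarse n"
      using coarse_structure_unipotent_coarse[of n] E unfolding coarse_structure_def by blast
    then obtain b c where b: "\<forall>(X, Y)\<in>E. f X \<le> f Y + b" and c: "\<forall>(X, Y)\<in>E\<inverse>. f X \<le> f Y + c"
      using up[OF E] up[of "E\<inverse>"] by blast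
    have "dist (f X) (f Y) \<le> max b c" if "(X, Y) \<in> E" for X Y
    proof -
      have "f X \<le> f Y + b" "f Y \<le> f X + c" using b c that by blast+
      then show ?thesis by (simp add: dist_real_def abs_le_iff) linarith
    qed
    then show ?thesis unfolding bounded_coarse_def by blast
  qed
  then show ?thesis unfolding controlled_map_def by blast
qed

lemma unipotent_int_pow:
  assumes X: "X \<in> carrier (\<N> n)" and e: "\<epsilon> \<in> {1, -1 :: int}"
  shows "X [^]\<^bsub>\<B> n\<^esub> \<epsilon> = (if \<epsilon> = 1 then X else inv\<^bsub>\<N> n\<^esub> X)"
    and "X [^]\<^bsub>\<B> n\<^esub> \<epsilon> \<in> carrier (\<N> n)"
proof -
  interpret B: group "\<B> n" by (rule group_upper_group)
  interpret N: group "\<N> n" by (rule group_unipotent_group)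
  have XB: "X \<in> carrier (\<B> n)" using X by simp
  show eq: "X [^]\<^bsub>\<B> n\<^esub> \<epsilon> = (if \<epsilon> = 1 then X else inv\<^bsub>\<N> n\<^esub> X)"
    using e B.int_pow_1[OF XB] B.int_pow_neg[OF XB, of 1] inv_unipotent_group[OF X] by auto
  show "X [^]\<^bsub>\<B> n\<^esub> \<epsilon> \<in> carrier (\<N> n)"
    unfolding eq using X N.inv_closed[OF X] by presburger
qed

text \<open>Inversion turns \<open>A * Y * C\<close> into the product of the inverses in reverse
  order. The outer factors trade places but remain perturbations with the same bound.\<close>

lemma unipotent_int_pow_perturbation:
  assumes A: "perturbation n R A" and C: "perturbation n R C" and Y: "Y \<in> carrier (\<N> n)"
    and e: "\<epsilon> \<in> {1, -1 :: int}"
  obtains A' C' where "perturbation n R A'" "perturbation n R C'"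
    "(A * Y * C) [^]\<^bsub>\<B> n\<^esub> \<epsilon> = A' * (Y [^]\<^bsub>\<B> n\<^esub> \<epsilon>) * C'"
proof -
  interpret N: group "\<N> n" by (rule group_unipotent_group)
  have AN: "A \<in> carrier (\<N> n)" and CN: "C \<in> carrier (\<N> n)"
    using A C unfolding perturbation_def by blast+
  have AY: "A * Y \<in> carrier (\<N> n)" and AYC: "A * Y * C \<in> carrier (\<N> n)"
    using N.m_closed[OF AN Y] N.m_closed[of "A * Y" C] CN unfolding unipotent_group_simps(2) by blast+
  show ?thesis
  proof (cases "\<epsilon> = 1")
    case True
    then show ?thesis
      using that[OF A C] unipotent_int_pow(1)[OF AYC e] unipotent_int_pow(1)[OF Y e] by simp
  next
    case False
    have iN: "inv\<^bsub>\<N> n\<^esub> A \<in> carrier_mat n n" "inv\<^bsub>\<N> n\<^esub> Y \<in> carrier_mat n n" "inv\<^bsub>\<N> n\<^esub> C \<in> carrier_mat n n"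
      using N.inv_closed[OF AN] N.inv_closed[OF Y] N.inv_closed[OF CN] by auto
    have "inv\<^bsub>\<N> n\<^esub> (A * Y * C) = inv\<^bsub>\<N> n\<^esub> C * (inv\<^bsub>\<N> n\<^esub> Y * inv\<^bsub>\<N> n\<^esub> A)"
      using N.inv_mult_group[OF AY CN] N.inv_mult_group[OF AN Y] unfolding unipotent_group_simps(2) by simp
    also have "\<dots> = inv\<^bsub>\<N> n\<^esub> C * inv\<^bsub>\<N> n\<^esub> Y * inv\<^bsub>\<N> n\<^esub> A"
      using assoc_mult_mat[OF iN(3,2,1)] by simp
    finally show ?thesis
      using that[OF perturbation_inv[OF C] perturbation_inv[OF A]] False
        unipotent_int_pow(1)[OF AYC e] unipotent_int_pow(1)[OF Y e] by simp
  qed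
qed

section \<open>Controlledness of the coordinate functions\<close>

lemma mat_norm_block_ge_1:
  assumes X: "X \<in> carrier (\<N> n)" and i: "1 \<le> i" "j \<le> n" and q: "q \<le> j - (i - 1)"
  shows "1 \<le> mat_norm (ext_power q (\<Phi> i j X))"
  by (rule mat_norm_ext_power_unitriangular_ge_1[OF block_carrier_mat block_unitriangular[of X n]])
    (use X i q in auto)

lemma controlled_map_mu:
  assumes l: "(i, j, q, \<epsilon>) \<in> \<Lambda>\<^sub>1 n"
  shows "controlled_map (carrier (\<N> n)) (unipotent_coarse n) UNIV real_line_coarse
    (\<lambda>X. ln (mat_norm (ext_power q (\<Phi> i j (X [^]\<^bsub>\<B> n\<^esub> \<epsilon>)))))"
    (is "controlled_map _ _ _ _ (\<lambda>X. ln (?f (X [^]\<^bsub>\<B> n\<^esub> \<epsilon>)))")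
proof (rule controlled_map_unipotent_coarseI)
  fix R
  let ?m = "j - (i - 1)"
  have i: "1 \<le> i" "j \<le> n" and q: "q \<le> ?m" and e: "\<epsilon> \<in> {1, -1}"
    using l by (auto simp: Lambda1_def)
  interpret N: group "\<N> n" by (rule group_unipotent_group)
  \<comment> \<open>One factor \<open>(real ?m * R) ^ q\<close> for each side of the product;
    \<open>K\<close> is fixed before \<open>A\<close>, \<open>Y\<close> and \<open>C\<close>, and
    \<open>ln K\<close> is the additive constant.\<close>
  define K where "K = (real ?m * R) ^ q * (real ?m * R) ^ q"
  show "\<exists>b. \<forall>A Y C. perturbation n R A \<longrightarrow> perturbation n R C \<longrightarrow> Y \<in> carrier (\<N> n) \<longrightarrow>
      ln (?f ((A * Y * C) [^]\<^bsub>\<B> n\<^esub> \<epsilon>)) \<le> ln (?f (Y [^]\<^bsub>\<B> n\<^esub> \<epsilon>)) + b"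
  proof (intro exI allI impI)
    fix A Y C assume A: "perturbation n R A" and C: "perturbation n R C" and Y: "Y \<in> carrier (\<N> n)"
    obtain A' C' where A': "perturbation n R A'" and C': "perturbation n R C'"
      and pow: "(A * Y * C) [^]\<^bsub>\<B> n\<^esub> \<epsilon> = A' * (Y [^]\<^bsub>\<B> n\<^esub> \<epsilon>) * C'"
      by (rule unipotent_int_pow_perturbation[OF A C Y e])
    define Z where "Z = Y [^]\<^bsub>\<B> n\<^esub> \<epsilon>"
    have Z: "Z \<in> carrier (\<N> n)" unfolding Z_def by (rule unipotent_int_pow(2)[OF Y e])
    have A'N: "A' \<in> carrier (\<N> n)" and C'N: "C' \<in> carrier (\<N> n)"
      using A' C' unfolding perturbation_def by blast+
    have A'Z: "A' * Z \<in> carrier (\<N> n)" and A'ZC': "A' * Z * C' \<in> carrier (\<N> n)"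
      using N.m_closed[OF A'N Z] N.m_closed[of "A' * Z" C'] C'N
      unfolding unipotent_group_simps(2) by blast+
    have mult: "\<Phi> i j (A' * Z * C') = \<Phi> i j A' * \<Phi> i j Z * \<Phi> i j C'"
      using block_mult[of "A' * Z" n C' i j] block_mult[of A' n Z i j] A'Z A'N Z C'N i by simp
    have ent: "\<bar>\<Phi> i j B $$ (a, b)\<bar> \<le> R" if B: "perturbation n R B" and ab: "a < ?m" "b < ?m" for B a b
    proof -
      have "B \<in> carrier_mat n n" using B unfolding perturbation_def by simp
      moreover have "i - 1 + a < n" "i - 1 + b < n" using ab i by auto
      ultimately show ?thesis
        using B ab i unfolding perturbation_def by (simp add: block_eq)
    qed
    have le: "?f (A' * Z * C') \<le> K * ?f Z"
      unfolding mult K_def mult.assoc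
      by (rule mat_norm_ext_power_mult_mult_le) (use A'N Z C'N i q A' C' ent block_carrier_mat in auto)
    have Z1: "1 \<le> ?f Z" and "1 \<le> ?f (A' * Z * C')"
      using mat_norm_block_ge_1[OF Z i q] mat_norm_block_ge_1[OF A'ZC' i q] by auto
    then have pos: "0 < K * ?f Z" using le by linarith
    \<comment> \<open>The sign of \<open>R\<close> is unknown, so positivity of \<open>K\<close> is
      read off from the product with a norm that is at least 1.\<close>
    then have K: "0 < K" using Z1 by (simp add: zero_less_mult_iff)
    have "ln (?f (A' * Z * C')) \<le> ln (K * ?f Z)"
      using le \<open>1 \<le> ?f (A' * Z * C')\<close> by simp
    also have "\<dots> = ln (?f Z) + ln K" using K Z1 by (simp add: ln_mult)
    finally show "ln (?f ((A * Y * C) [^]\<^bsub>\<B> n\<^esub> \<epsilon>)) \<le> ln (?f (Y [^]\<^bsub>\<B> n\<^esub> \<epsilon>)) + ln K"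
      unfolding pow Z_def .
  qed
qed

text \<open>Triangularity leaves only the terms \<open>k = i\<close> and \<open>k = Suc i\<close>,
  and each of them has a diagonal entry 1 as one factor.\<close>

lemma unipotent_mult_superdiagonal:
  assumes X: "X \<in> carrier (\<N> n)" and Y: "Y \<in> carrier (\<N> n)" and i: "Suc i < n"
  shows "(X * Y) $$ (i, Suc i) = X $$ (i, Suc i) + Y $$ (i, Suc i)"
proof -
  have X': "X \<in> carrier_mat n n" "upper_triangular X" and Y': "Y \<in> carrier_mat n n" "upper_triangular Y"
    using X Y by auto
  have "(X * Y) $$ (i, Suc i) = (\<Sum>k<n. X $$ (i, k) * Y $$ (k, Suc i))"
    using X' Y' i by (intro index_mult_upper) auto
  also have "\<dots> = (\<Sum>k\<in>{i, Suc i}. X $$ (i, k) * Y $$ (k, Suc i))"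
  proof (rule sum.mono_neutral_right)
    show "\<forall>k\<in>{..<n} - {i, Suc i}. X $$ (i, k) * Y $$ (k, Suc i) = 0"
    proof
      fix k assume "k \<in> {..<n} - {i, Suc i}"
      then consider "k < i" | "Suc i < k" "k < n" by fastforce
      then show "X $$ (i, k) * Y $$ (k, Suc i) = 0"
        using X'(1) Y'(1) i upper_triangularD[OF X'(2), of k i]
          upper_triangularD[OF Y'(2), of "Suc i" k] by cases auto
    qed
  qed (use i in auto)
  also have "\<dots> = X $$ (i, Suc i) + Y $$ (i, Suc i)" using X Y i by simp
  finally show ?thesis .
qed

lemma controlled_map_alpha:
  assumes "i \<in> {1..n - 1}"
  shows "controlled_map (carrier (\<N> n)) (unipotent_coarse n) UNIV real_line_coarse (\<alpha> i)"
proof (rule controlled_map_unipotent_coarseI)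
  fix R
  interpret N: group "\<N> n" by (rule group_unipotent_group)
  \<comment> \<open>The label \<open>i\<close> counts from 1, so the entry in question sits at the
    position \<open>(k, Suc k)\<close>.\<close>
  obtain k where k: "i = Suc k" "Suc k < n" using assms by (cases i) auto
  show "\<exists>b. \<forall>A Y C. perturbation n R A \<longrightarrow> perturbation n R C \<longrightarrow> Y \<in> carrier (\<N> n) \<longrightarrow>
      \<alpha> i (A * Y * C) \<le> \<alpha> i Y + b"
  proof (intro exI allI impI)
    fix A Y C assume A: "perturbation n R A" and C: "perturbation n R C" and Y: "Y \<in> carrier (\<N> n)"
    have AN: "A \<in> carrier (\<N> n)" and CN: "C \<in> carrier (\<N> n)"
      using A C unfolding perturbation_def by blast+
    have AY: "A * Y \<in> carrier (\<N> n)"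
      using N.m_closed[OF AN Y] unfolding unipotent_group_simps(2) .
    have "\<bar>A $$ (k, Suc k)\<bar> \<le> R" "\<bar>C $$ (k, Suc k)\<bar> \<le> R"
      using A C k unfolding perturbation_def by auto
    then have "(A * Y * C) $$ (k, Suc k) \<le> Y $$ (k, Suc k) + (R + R)"
      unfolding unipotent_mult_superdiagonal[OF AY CN k(2)] unipotent_mult_superdiagonal[OF AN Y k(2)]
      by linarith
    then show "\<alpha> i (A * Y * C) \<le> \<alpha> i Y + (R + R)"
      by (simp add: alpha_def k(1) del: index_mult_mat)
  qed
qed

text \<open>The Euclidean distance is at most the sum of the coordinate distances, so the sum of the
  finitely many coordinate bounds works for the tuple.\<close>

lemma controlled_map_real_space:
  assumes K: "finite K" and range: "\<And>x. x \<in> S \<Longrightarrow> f x \<in> real_space K"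
    and sub: "\<And>E. E \<in> \<E> \<Longrightarrow> E \<subseteq> S \<times> S"
    and coord: "\<And>k. k \<in> K \<Longrightarrow> controlled_map S \<E> UNIV real_line_coarse (\<lambda>x. f x k)"
  shows "controlled_map S \<E> (real_space K) (real_space_coarse K) f"
proof -
  have "{(f x, f y) | x y. (x, y) \<in> E} \<in> real_space_coarse K" if E: "E \<in> \<E>" for E
  proof -
    have "\<exists>b. \<forall>(x, y)\<in>E. \<bar>f x k - f y k\<bar> \<le> b" if "k \<in> K" for k
    proof -
      have "{(f x k, f y k) | x y. (x, y) \<in> E} \<in> real_line_coarse"
        using coord[OF that] E unfolding controlled_map_def by blast
      then show ?thesis unfolding bounded_coarse_def by (fastforce simp: dist_real_def)
    qed
    then obtain b where b: "\<And>k x y. k \<in> K \<Longrightarrow> (x, y) \<in> E \<Longrightarrow> \<bar>f x k - f y k\<bar> \<le> b k"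
      by (metis (no_types, lifting) case_prodD)
    have "real_space_dist K (f x) (f y) \<le> sum b K" if "(x, y) \<in> E" for x y
    proof -
      have "real_space_dist K (f x) (f y) \<le> (\<Sum>k\<in>K. \<bar>f x k - f y k\<bar>)"
        unfolding real_space_dist_def by (rule L2_set_le_sum_abs)
      also have "\<dots> \<le> sum b K" by (rule sum_mono) (use b that in blast)
      finally show ?thesis .
    qed
    then show ?thesis using range sub[OF E] unfolding bounded_coarse_def by blast
  qed
  then show ?thesis using range unfolding controlled_map_def by blast
qed


section \<open>Coarse properness\<close>

text \<open>The set is the image of a product of compact sets of reals under the continuous map that
  assembles a matrix from its entries.\<close>

lemma compactin_unipotent_entries_le:
  "compactin (subtopology (mat_topology n) (carrier (\<N> n)))
     {X \<in> carrier (\<N> n). \<forall>i<n. \<forall>j<n. \<bar>X $$ (i, j)\<bar> \<le> R}" (is "compactin _ ?C")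
proof -
  \<comment> \<open>The values allowed at position \<open>p\<close>: the bound \<open>R\<close>,
    combined with the prescribed 0 below and 1 on the diagonal.\<close>
  define S where "S p = {-R..R} \<inter> (if snd p < fst p then {0} else if fst p = snd p then {1} else UNIV)"
    for p :: "nat \<times> nat"
  let ?K = "{..<n} \<times> {..<n}"
  let ?P = "powertop_real ?K"
  \<comment> \<open>Membership in \<open>\<N> n\<close> includes invertibility; the determinant is
    1, so the adjugate is the inverse.\<close>
  have inv: "invertible_mat X" if "X \<in> carrier_mat n n" "upper_triangular X" "\<forall>i<n. X $$ (i, i) = 1"
    for X :: "real mat"
  proof -
    have "diag_mat X = replicate n 1" using that by (auto simp: diag_mat_def intro: nth_equalityI)
    then have "det X = 1" using det_upper_triangular[OF that(2,1)] by simp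
    then have "adj_mat X \<in> carrier_mat n n" "X * adj_mat X = 1\<^sub>m n" "adj_mat X * X = 1\<^sub>m n"
      using adj_mat[OF that(1)] by auto
    then show ?thesis using that(1) by (intro invertible_matI)
  qed
  have "compact (S p)" for p unfolding S_def by (intro compact_Int_closed) auto
  then have P: "compactin ?P (PiE ?K S)" by (simp add: compactin_PiE)
  have "continuous_map ?P (mat_topology n) (\<lambda>g. mat n n g)"
    by (rule continuous_map_into_mat_topology) (auto intro!: continuous_map_product_projection)
  with P have cpt: "compactin (mat_topology n) ((\<lambda>g. mat n n g) ` PiE ?K S)"
    by (rule image_compactin)
  have "(\<lambda>g. mat n n g) ` PiE ?K S = ?C"
  proof (intro Set.set_eqI iffI)
    fix X assume "X \<in> (\<lambda>g. mat n n g) ` PiE ?K S"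
    then obtain g where g: "g \<in> PiE ?K S" and X: "X = mat n n g" by blast
    have gS: "g (i, j) \<in> S (i, j)" if "i < n" "j < n" for i j
      using PiE_mem[OF g, of "(i, j)"] that by simp
    have ut: "upper_triangular X"
    proof
      fix i j assume "j < i" "i < dim_row X"
      then show "X $$ (i, j) = 0" using gS[of i j] by (simp add: X S_def)
    qed
    have diag: "\<forall>i<n. X $$ (i, i) = 1"
    proof (intro allI impI)
      fix i assume "i < n"
      then show "X $$ (i, i) = 1" using gS[of i i] by (simp add: X S_def)
    qed
    have "\<bar>X $$ (i, j)\<bar> \<le> R" if "i < n" "j < n" for i j
      using gS[OF that] that by (auto simp: X S_def)
    then show "X \<in> ?C"
      using inv[of X] ut diag by (auto simp: X)
  next
    fix X assume X: "X \<in> ?C"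
    then have X': "X \<in> carrier_mat n n" "upper_triangular X" "\<forall>i<n. X $$ (i, i) = 1"
      and R: "\<And>i j. i < n \<Longrightarrow> j < n \<Longrightarrow> \<bar>X $$ (i, j)\<bar> \<le> R" by auto
    have "X $$ (i, j) \<in> S (i, j)" if "i < n" "j < n" for i j
      using R[OF that] X' that upper_triangularD[OF X'(2), of j i] by (auto simp: S_def abs_le_iff minus_le_iff)
    then have "restrict (\<lambda>p. X $$ p) ?K \<in> PiE ?K S" by auto
    moreover have "X = mat n n (restrict (\<lambda>p. X $$ p) ?K)" using X'(1) by auto
    ultimately show "X \<in> (\<lambda>g. mat n n g) ` PiE ?K S" by blast
  qed
  then have "compactin (mat_topology n) ?C" using cpt by simp
  then show ?thesis unfolding compactin_subtopology by blast
qed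

text \<open>The identity X = X Y Y^{-1} exhibits X as c Y d^{-1} with c = X and d = Y, both in the
  compact set of matrices with entries bounded by \<open>R\<close>.\<close>

lemma coarsely_bounded_unipotent:
  assumes S: "S \<subseteq> carrier (\<N> n)" and le: "\<And>X i j. X \<in> S \<Longrightarrow> i < n \<Longrightarrow> j < n \<Longrightarrow> \<bar>X $$ (i, j)\<bar> \<le> R"
  shows "coarsely_bounded (unipotent_coarse n) S"
proof -
  interpret N: group "\<N> n" by (rule group_unipotent_group)
  let ?C = "{X \<in> carrier (\<N> n). \<forall>i<n. \<forall>j<n. \<bar>X $$ (i, j)\<bar> \<le> R}"
  have SC: "S \<subseteq> ?C" using S le by blast
  have "X \<in> (?C #>\<^bsub>\<N> n\<^esub> Y) <#>\<^bsub>\<N> n\<^esub> (set_inv\<^bsub>\<N> n\<^esub> ?C)" if "X \<in> S" "Y \<in> S" for X Y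
  proof -
    have c: "X \<in> carrier (\<N> n)" "Y \<in> carrier (\<N> n)" using S that by blast+
    have "X \<otimes>\<^bsub>\<N> n\<^esub> Y \<in> ?C #>\<^bsub>\<N> n\<^esub> Y" using that SC unfolding r_coset_def by blast
    moreover have "inv\<^bsub>\<N> n\<^esub> Y \<in> set_inv\<^bsub>\<N> n\<^esub> ?C" using that SC unfolding SET_INV_def by blast
    moreover have "X = (X \<otimes>\<^bsub>\<N> n\<^esub> Y) \<otimes>\<^bsub>\<N> n\<^esub> inv\<^bsub>\<N> n\<^esub> Y"
      by (rule N.inv_solve_right'[OF c(1) N.m_closed[OF c] c(2), THEN iffD2, symmetric]) (rule refl)
    ultimately show ?thesis unfolding set_mult_def by blast
  qed
  then show ?thesis
    unfolding coarsely_bounded_def LR_coarse_def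
    using S compactin_unipotent_entries_le[of n R] by blast
qed

lemma coarsely_bounded_alpha_0_le:
  assumes S: "S \<subseteq> carrier (\<N> n)" and le: "\<And>X. X \<in> S \<Longrightarrow> \<alpha> 0 X \<le> c"
  shows "coarsely_bounded (unipotent_coarse n) S"
proof (rule coarsely_bounded_unipotent[OF S])
  fix X i j assume X: "X \<in> S" and ij: "i < n" "j < n"
  have XN: "X \<in> carrier_mat n n" "\<forall>i<n. X $$ (i, i) = 1" using S X by auto
  have ent: "\<bar>X $$ (k, l)\<bar> \<le> mat_norm X" if "k < n" "l < n" for k l
    using XN that by (intro abs_le_mat_norm) blast
  \<comment> \<open>A diagonal entry makes the norm positive, which is what allows the logarithm to
    be inverted by \<open>exp\<close>.\<close>
  have "1 \<le> mat_norm X" using ent[of i i] XN ij by simp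
  moreover have "ln (mat_norm X) \<le> c" using le[OF X] by (simp add: alpha_def)
  ultimately have "mat_norm X \<le> exp c" using exp_le_cancel_iff[of "ln (mat_norm X)" c] by simp
  then show "\<bar>X $$ (i, j)\<bar> \<le> exp c" using ent[OF ij] by linarith
qed

text \<open>Lets controlledness of \<open>\<alpha> 0\<close> come from
  \<open>controlled_map_mu\<close>.\<close>

lemma alpha_0_eq:
  assumes X: "X \<in> carrier (\<N> n)"
  shows "\<alpha> 0 X = ln (mat_norm (ext_power 1 (\<Phi> 1 n (X [^]\<^bsub>\<B> n\<^esub> (1 :: int)))))"
proof -
  have "X \<in> carrier_mat n n" using X by simp
  moreover have "X [^]\<^bsub>\<B> n\<^esub> (1 :: int) = X" using unipotent_int_pow(1)[OF X, of 1] by simp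
  ultimately show ?thesis
    using block_full[of X n] elements_ext_power_1[of X n] by (simp add: alpha_def mat_norm_def)
qed

lemma controlled_map_cong:
  assumes "controlled_map S \<E> T \<F> f" "\<And>E. E \<in> \<E> \<Longrightarrow> E \<subseteq> S \<times> S" "\<And>x. x \<in> S \<Longrightarrow> f x = g x"
  shows "controlled_map S \<E> T \<F> g"
proof -
  have "{(g x, g y) | x y. (x, y) \<in> E} = {(f x, f y) | x y. (x, y) \<in> E}" if "E \<in> \<E>" for E
  proof -
    have "g x = f x \<and> g y = f y" if "(x, y) \<in> E" for x y
      using assms(2)[OF \<open>E \<in> \<E>\<close>] assms(3) that by auto
    then show ?thesis by (intro Collect_cong iff_exI) auto
  qed
  then show ?thesis using assms(1,3) unfolding controlled_map_def by (auto simp: Pi_iff)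
qed

lemma unipotent_coarse_subset: "E \<in> unipotent_coarse n \<Longrightarrow> E \<subseteq> carrier (\<N> n) \<times> carrier (\<N> n)"
  unfolding LR_coarse_def by blast

lemma controlled_map_alpha_0:
  assumes "1 \<le> n"
  shows "controlled_map (carrier (\<N> n)) (unipotent_coarse n) UNIV real_line_coarse (\<alpha> 0)"
proof (rule controlled_map_cong[OF _ unipotent_coarse_subset alpha_0_eq[symmetric]])
  show "controlled_map (carrier (\<N> n)) (unipotent_coarse n) UNIV real_line_coarse
    (\<lambda>X. ln (mat_norm (ext_power 1 (\<Phi> 1 n (X [^]\<^bsub>\<B> n\<^esub> (1 :: int))))))"
    by (rule controlled_map_mu) (use assms in \<open>simp add: Lambda1_def\<close>)
qed

text \<open>Comparison with one fixed point \<open>Y\<close> of the preimage bounds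
  \<open>\<alpha> 0\<close> from above on the whole preimage, which is then bounded because
  \<open>\<alpha> 0\<close> controls all entries.\<close>

lemma coarsely_proper_map_dominating_alpha_0:
  assumes range: "\<And>X. X \<in> carrier (\<N> n) \<Longrightarrow> f X \<in> T"
    and le: "\<And>X Y. X \<in> carrier (\<N> n) \<Longrightarrow> Y \<in> carrier (\<N> n) \<Longrightarrow> \<alpha> 0 X - \<alpha> 0 Y \<le> d (f X) (f Y)"
  shows "coarsely_proper_map (carrier (\<N> n)) (unipotent_coarse n) T (bounded_coarse T d) f"
  unfolding coarsely_proper_map_def
proof (intro conjI allI impI)
  fix B assume "coarsely_bounded (bounded_coarse T d) B"
  then obtain b where b: "\<And>x y. x \<in> B \<Longrightarrow> y \<in> B \<Longrightarrow> d x y \<le> b"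
    unfolding coarsely_bounded_def bounded_coarse_def by blast
  let ?A = "{X \<in> carrier (\<N> n). f X \<in> B}"
  have "\<exists>c. \<forall>X\<in>?A. \<alpha> 0 X \<le> c"
  proof (cases "?A = {}")
    case False
    then obtain Y where Y: "Y \<in> ?A" by blast
    have "\<alpha> 0 X \<le> \<alpha> 0 Y + b" if "X \<in> ?A" for X
      using le[of X Y] b[of "f X" "f Y"] Y that by force
    then show ?thesis by blast
  qed blast
  then obtain c where "\<And>X. X \<in> ?A \<Longrightarrow> \<alpha> 0 X \<le> c" by blast
  then show "coarsely_bounded (unipotent_coarse n) ?A"
    by (intro coarsely_bounded_alpha_0_le[of ?A n c]) blast+
qed (use range in blast)

lemma finite_Lambda1: "finite (\<Lambda>\<^sub>1 n)"
  by (rule finite_subset[of _ "{1..n} \<times> {1..n} \<times> {1..n} \<times> {1, -1}"]) (auto simp: Lambda1_def)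

text \<open>Controlledness is checked coordinate by coordinate. Properness comes from the coordinate
  \<open>Inl 0\<close>, which is \<open>\<alpha> 0\<close>: its differences are at most the
  Euclidean distance.\<close>

lemma coarse_map_alpha_mu:
  assumes n: "1 \<le> n" and I: "I \<subseteq> {0..n-1}" "0 \<in> I" and L: "\<Lambda> \<subseteq> \<Lambda>\<^sub>1 n"
  shows "coarse_map (carrier (\<N> n)) (unipotent_coarse n)
    (real_space (I <+> \<Lambda>)) (real_space_coarse (I <+> \<Lambda>)) (alpha_mu n I \<Lambda>)"
  unfolding coarse_map_def
proof
  have fin: "finite (I <+> \<Lambda>)"
    using I(1) L finite_Lambda1[of n] by (auto intro: finite_subset)
  have range: "alpha_mu n I \<Lambda> X \<in> real_space (I <+> \<Lambda>)" for X
    by (simp add: alpha_mu_def real_space_def)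
  show "controlled_map (carrier (\<N> n)) (unipotent_coarse n)
    (real_space (I <+> \<Lambda>)) (real_space_coarse (I <+> \<Lambda>)) (alpha_mu n I \<Lambda>)"
  proof (rule controlled_map_real_space[OF fin range unipotent_coarse_subset])
    fix k assume k: "k \<in> I <+> \<Lambda>"
    show "controlled_map (carrier (\<N> n)) (unipotent_coarse n) UNIV real_line_coarse
      (\<lambda>X. alpha_mu n I \<Lambda> X k)"
    proof (cases k)
      case (Inl i)
      then have "i \<in> I" using k by auto
      then have "controlled_map (carrier (\<N> n)) (unipotent_coarse n) UNIV real_line_coarse (\<alpha> i)"
        using controlled_map_alpha[of i n] controlled_map_alpha_0[OF n] I(1) by (cases "i = 0") auto
      moreover have "(\<lambda>X. alpha_mu n I \<Lambda> X k) = \<alpha> i"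
        using Inl \<open>i \<in> I\<close> by (simp add: alpha_mu_def fun_eq_iff InlI)
      ultimately show ?thesis by simp
    next
      case (Inr l)
      obtain i j q \<epsilon> where l: "l = (i, j, q, \<epsilon>)" by (cases l) auto
      have "(i, j, q, \<epsilon>) \<in> \<Lambda>" using k Inr l by auto
      then have "(\<lambda>X. alpha_mu n I \<Lambda> X k) = (\<lambda>X. ln (mat_norm (ext_power q (\<Phi> i j (X [^]\<^bsub>\<B> n\<^esub> \<epsilon>)))))"
        using Inr l by (simp add: alpha_mu_def mu_def fun_eq_iff InrI)
      then show ?thesis using controlled_map_mu[of i j q \<epsilon> n] \<open>(i, j, q, \<epsilon>) \<in> \<Lambda>\<close> L by auto
    qed
  qed
  show "coarsely_proper_map (carrier (\<N> n)) (unipotent_coarse n)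
    (real_space (I <+> \<Lambda>)) (real_space_coarse (I <+> \<Lambda>)) (alpha_mu n I \<Lambda>)"
  proof (rule coarsely_proper_map_dominating_alpha_0[OF range])
    fix X Y
    have "alpha_mu n I \<Lambda> Z (Inl 0) = \<alpha> 0 Z" for Z
      using I(2) by (simp add: alpha_mu_def InlI)
    then show "\<alpha> 0 X - \<alpha> 0 Y \<le> real_space_dist (I <+> \<Lambda>) (alpha_mu n I \<Lambda> X) (alpha_mu n I \<Lambda> Y)"
      using member_le_L2_set[OF fin, of "Inl 0" "\<lambda>k. alpha_mu n I \<Lambda> X k - alpha_mu n I \<Lambda> Y k"] I(2)
      by (simp add: real_space_dist_def InlI)
  qed
qed

theorem theorem6p3:
  fixes n :: nat
  assumes "n \<ge> 2"
  shows
    "((\<forall>X\<in>carrier (\<N> n). \<alpha> 0 X = \<mu> n {(1, n, 1, 1)} X (1, n, 1, 1)) \<and>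
      coarse_map (carrier (\<N> n)) (unipotent_coarse n) UNIV real_line_coarse (\<alpha> 0)) \<and>
     (\<forall>i\<in>{1..n-1}.
        controlled_map (carrier (\<N> n)) (unipotent_coarse n) UNIV real_line_coarse (\<alpha> i)) \<and>
     (\<forall>I \<Lambda>. I \<subseteq> {0..n-1} \<longrightarrow> 0 \<in> I \<longrightarrow> \<Lambda> \<subseteq> \<Lambda>\<^sub>1 n \<longrightarrow>
        coarse_map (carrier (\<N> n)) (unipotent_coarse n)
          (real_space (I <+> \<Lambda>)) (real_space_coarse (I <+> \<Lambda>)) (alpha_mu n I \<Lambda>))"
proof (intro conjI ballI allI impI)
  have n: "1 \<le> n" using assms by simp
  show "coarse_map (carrier (\<N> n)) (unipotent_coarse n) UNIV real_line_coarse (\<alpha> 0)"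
    unfolding coarse_map_def
    \<comment> \<open>For \<open>\<alpha> 0\<close> itself, domination is the inequality between a
      difference of reals and its absolute value.\<close>
    by (intro conjI controlled_map_alpha_0[OF n] coarsely_proper_map_dominating_alpha_0)
      (auto simp: dist_real_def)
  show "\<alpha> 0 X = \<mu> n {(1, n, 1, 1)} X (1, n, 1, 1)" if "X \<in> carrier (\<N> n)" for X
    unfolding alpha_0_eq[OF that] by (simp add: mu_def)
  show "coarse_map (carrier (\<N> n)) (unipotent_coarse n)
    (real_space (I <+> \<Lambda>)) (real_space_coarse (I <+> \<Lambda>)) (alpha_mu n I \<Lambda>)"
    if "I \<subseteq> {0..n-1}" "0 \<in> I" "\<Lambda> \<subseteq> \<Lambda>\<^sub>1 n" for I \<Lambda>
    by (rule coarse_map_alpha_mu[OF n that])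
qed (rule controlled_map_alpha)

end
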